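(* Let $R$ be a commutative noetherian ring and $Q=(Q_0,Q_1)$ a finite acyclic quiver. Given left $RQ$-modules $X$ and $Y$, the internal hom for the vertexwise tensor product $\boxtimes_{RQ}$ on $\operatorname{Mod}(RQ)$ (i.e. the value at $Y$ of the right adjoint of $X\boxtimes_{RQ}-$) is the representation $$\mathcal{H}om_{RQ}(X,Y)=\Big(\operatorname{Hom}_{RQ}(X\boxtimes_{RQ}P(i),Y),\ -\circ(\mathrm{id}_X\boxtimes_{RQ}\iota_\alpha)\Big)_{i\in Q_0,\ \alpha\in Q_1}.$$ That is, its module at the vertex $i$ is $\operatorname{Hom}_{RQ}(X\boxtimes_{RQ}P(i),Y)$, and for an arrow $\alpha:i\to j$ its structure map $\operatorname{Hom}_{RQ}(X\boxtimes_{RQ}P(i),Y)\to\operatorname{Hom}_{RQ}(X\boxtimes_{RQ}P(j),Y)$ is precomposition with $\mathrm{id}_X\boxtimes_{RQ}\iota_\alpha$.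
   Context: $RQ$ is the path algebra of $Q$ over $R$; left $RQ$-modules are identified with representations $X=(X_i,X_\alpha)$ of $Q$ by $R$-modules ($X_\alpha:X_i\to X_j$ for an arrow $\alpha:i\to j$). The vertexwise tensor product is $X\boxtimes_{RQ}Y=(X_i\otimes_R Y_i,\,X_\alpha\otimes_R Y_\alpha)$. For $i\in Q_0$, $P(i)$ is the projective $RQ$-module such that $P(i)_k$ is the free $R$-module on the set of all paths in $Q$ from $i$ to $k$, and for an arrow $\beta:k\to\ell$ the map $P(i)_\beta$ is left multiplication by $\beta$. For $\alpha:i\to j$ in $Q_1$, $\iota_\alpha:P(j)\to P(i)$ is the monomorphism given by right multiplication by $\alpha$. *)

theory Defs
  imports "Graph_Theory.Arc_Walk" "HOL-Algebra.Module" "HOL-Algebra.Ring_Divisibility"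
begin

text \<open>
  Modules are those of HOL-Algebra; the ring fields \<open>mult\<close> and \<open>one\<close> of a module record
  carry no meaning and are left undefined below. Every homomorphism is extensional
  (undefined off the carrier), so that equality of homomorphisms is equality in HOL
  and the sets of homomorphisms are the mathematical ones.
\<close>

definition mod_hom ::
    "('a, 'r) ring_scheme \<Rightarrow> ('a, 'm) module \<Rightarrow> ('a, 'n) module \<Rightarrow> ('m \<Rightarrow> 'n) set" where
  "mod_hom R M N = {h \<in> carrier M \<rightarrow>\<^sub>E carrier N.
     (\<forall>x\<in>carrier M. \<forall>y\<in>carrier M. h (x \<oplus>\<^bsub>M\<^esub> y) = h x \<oplus>\<^bsub>N\<^esub> h y) \<and>
     (\<forall>r\<in>carrier R. \<forall>x\<in>carrier M. h (r \<odot>\<^bsub>M\<^esub> x) = r \<odot>\<^bsub>N\<^esub> h x)}"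

text \<open>The free module on \<open>S\<close>: finitely supported functions \<open>S \<rightarrow> R\<close>, extended by zero.\<close>

definition free_mod :: "('a, 'r) ring_scheme \<Rightarrow> 's set \<Rightarrow> ('a, 's \<Rightarrow> 'a) module" where
  "free_mod R S =
    \<lparr>carrier = {u. (\<forall>s. u s \<in> carrier R) \<and> (\<forall>s. s \<notin> S \<longrightarrow> u s = \<zero>\<^bsub>R\<^esub>) \<and> finite {s. u s \<noteq> \<zero>\<^bsub>R\<^esub>}},
     monoid.mult = undefined, one = undefined,
     ring.zero = (\<lambda>s. \<zero>\<^bsub>R\<^esub>),
     ring.add = (\<lambda>u w s. u s \<oplus>\<^bsub>R\<^esub> w s),
     module.smult = (\<lambda>r u s. r \<otimes>\<^bsub>R\<^esub> u s)\<rparr>"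

definition free_gen :: "('a, 'r) ring_scheme \<Rightarrow> 's \<Rightarrow> 's \<Rightarrow> 'a" where
  "free_gen R s = (\<lambda>t. if t = s then \<one>\<^bsub>R\<^esub> else \<zero>\<^bsub>R\<^esub>)"

text \<open>The linear map sending the basis element \<open>s\<close> to the basis element \<open>f s\<close>.\<close>

definition free_map :: "('a, 'r) ring_scheme \<Rightarrow> ('s \<Rightarrow> 't) \<Rightarrow> ('s \<Rightarrow> 'a) \<Rightarrow> ('t \<Rightarrow> 'a)" where
  "free_map R f u = (\<lambda>t. finsum R u {s. u s \<noteq> \<zero>\<^bsub>R\<^esub> \<and> f s = t})"

definition submodule_span ::
    "('a, 'r) ring_scheme \<Rightarrow> ('a, 'm) module \<Rightarrow> 'm set \<Rightarrow> 'm set" where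
  "submodule_span R M S = \<Inter>{H. submodule H R M \<and> S \<subseteq> H}"

definition quot_mod :: "('a, 'm) module \<Rightarrow> 'm set \<Rightarrow> ('a, 'm set) module" where
  "quot_mod M H =
    \<lparr>carrier = a_rcosets\<^bsub>M\<^esub> H, monoid.mult = undefined, one = undefined,
     ring.zero = H, ring.add = set_add M,
     module.smult = (\<lambda>r C. \<Union>x\<in>C. H +>\<^bsub>M\<^esub> (r \<odot>\<^bsub>M\<^esub> x))\<rparr>"


text \<open>The tensor product of two modules, by generators and relations.\<close>

definition tensor_rels ::
    "('a, 'r) ring_scheme \<Rightarrow> ('a, 'm) module \<Rightarrow> ('a, 'n) module \<Rightarrow> ('m \<times> 'n \<Rightarrow> 'a) set" where
  "tensor_rels R M N =
    (let F = free_mod R (carrier M \<times> carrier N); d = (\<lambda>x y. free_gen R (x, y)) in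
      {d (x \<oplus>\<^bsub>M\<^esub> x') y \<ominus>\<^bsub>F\<^esub> (d x y \<oplus>\<^bsub>F\<^esub> d x' y) | x x' y.
          x \<in> carrier M \<and> x' \<in> carrier M \<and> y \<in> carrier N} \<union>
      {d x (y \<oplus>\<^bsub>N\<^esub> y') \<ominus>\<^bsub>F\<^esub> (d x y \<oplus>\<^bsub>F\<^esub> d x y') | x y y'.
          x \<in> carrier M \<and> y \<in> carrier N \<and> y' \<in> carrier N} \<union>
      {d (r \<odot>\<^bsub>M\<^esub> x) y \<ominus>\<^bsub>F\<^esub> (r \<odot>\<^bsub>F\<^esub> d x y) | r x y.
          r \<in> carrier R \<and> x \<in> carrier M \<and> y \<in> carrier N} \<union>
      {d x (r \<odot>\<^bsub>N\<^esub> y) \<ominus>\<^bsub>F\<^esub> (r \<odot>\<^bsub>F\<^esub> d x y) | r x y.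
          r \<in> carrier R \<and> x \<in> carrier M \<and> y \<in> carrier N})"

definition tensor_ker ::
    "('a, 'r) ring_scheme \<Rightarrow> ('a, 'm) module \<Rightarrow> ('a, 'n) module \<Rightarrow> ('m \<times> 'n \<Rightarrow> 'a) set" where
  "tensor_ker R M N =
    submodule_span R (free_mod R (carrier M \<times> carrier N)) (tensor_rels R M N)"

definition tensor ::
    "('a, 'r) ring_scheme \<Rightarrow> ('a, 'm) module \<Rightarrow> ('a, 'n) module
      \<Rightarrow> ('a, ('m \<times> 'n \<Rightarrow> 'a) set) module" where
  "tensor R M N = quot_mod (free_mod R (carrier M \<times> carrier N)) (tensor_ker R M N)"

text \<open>
  The map \<open>f \<otimes> g : M \<otimes> N \<rightarrow> M' \<otimes> N'\<close>, computed on representatives. All members of a coset \<open>C\<close>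
  give the same coset, so the union is that coset.
\<close>

definition tensor_map ::
    "('a, 'r) ring_scheme \<Rightarrow> ('a, 'm) module \<Rightarrow> ('a, 'n) module
      \<Rightarrow> ('a, 'm1) module \<Rightarrow> ('a, 'n1) module \<Rightarrow> ('m \<Rightarrow> 'm1) \<Rightarrow> ('n \<Rightarrow> 'n1)
      \<Rightarrow> ('m \<times> 'n \<Rightarrow> 'a) set \<Rightarrow> ('m1 \<times> 'n1 \<Rightarrow> 'a) set" where
  "tensor_map R M N M' N' f g =
    (\<lambda>C\<in>carrier (tensor R M N).
      \<Union>u\<in>C. a_r_coset (free_mod R (carrier M' \<times> carrier N')) (tensor_ker R M' N')
              (free_map R (map_prod f g) u))"


text \<open>
  A quiver is a multi-digraph (loops and parallel arcs allowed) of type \<^type>\<open>pre_digraph\<close>.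
  The data of a representation at indices outside \<open>verts Q\<close> and \<open>arcs Q\<close> are ignored.
\<close>

record ('v, 'e, 'a, 'm) qrep =
  vmod :: "'v \<Rightarrow> ('a, 'm) module"
  amap :: "'e \<Rightarrow> 'm \<Rightarrow> 'm"

definition is_rep ::
    "('a, 'r) ring_scheme \<Rightarrow> ('v, 'e) pre_digraph \<Rightarrow> ('v, 'e, 'a, 'm) qrep \<Rightarrow> bool" where
  "is_rep R Q X \<longleftrightarrow>
    (\<forall>i\<in>verts Q. module R (vmod X i)) \<and>
    (\<forall>\<alpha>\<in>arcs Q. amap X \<alpha> \<in> mod_hom R (vmod X (tail Q \<alpha>)) (vmod X (head Q \<alpha>)))"

definition rep_hom ::
    "('a, 'r) ring_scheme \<Rightarrow> ('v, 'e) pre_digraph \<Rightarrow> ('v, 'e, 'a, 'm) qrep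
      \<Rightarrow> ('v, 'e, 'a, 'n) qrep \<Rightarrow> ('v \<Rightarrow> 'm \<Rightarrow> 'n) set" where
  "rep_hom R Q X Y =
    {f \<in> (\<Pi>\<^sub>E i\<in>verts Q. mod_hom R (vmod X i) (vmod Y i)).
      \<forall>\<alpha>\<in>arcs Q. \<forall>x\<in>carrier (vmod X (tail Q \<alpha>)).
        f (head Q \<alpha>) (amap X \<alpha> x) = amap Y \<alpha> (f (tail Q \<alpha>) x)}"

definition rep_id ::
    "('v, 'e) pre_digraph \<Rightarrow> ('v, 'e, 'a, 'm) qrep \<Rightarrow> 'v \<Rightarrow> 'm \<Rightarrow> 'm" where
  "rep_id Q X = (\<lambda>i\<in>verts Q. \<lambda>x\<in>carrier (vmod X i). x)"

text \<open>\<open>rep_comp Q X g f\<close> is \<open>g \<circ> f\<close>, where \<open>X\<close> is the domain of \<open>f\<close>.\<close>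

definition rep_comp ::
    "('v, 'e) pre_digraph \<Rightarrow> ('v, 'e, 'a, 'm) qrep \<Rightarrow> ('v \<Rightarrow> 'n \<Rightarrow> 'k) \<Rightarrow> ('v \<Rightarrow> 'm \<Rightarrow> 'n)
      \<Rightarrow> 'v \<Rightarrow> 'm \<Rightarrow> 'k" where
  "rep_comp Q X g f = (\<lambda>i\<in>verts Q. compose (carrier (vmod X i)) (g i) (f i))"

definition hom_mod ::
    "('a, 'r) ring_scheme \<Rightarrow> ('v, 'e) pre_digraph \<Rightarrow> ('v, 'e, 'a, 'm) qrep
      \<Rightarrow> ('v, 'e, 'a, 'n) qrep \<Rightarrow> ('a, 'v \<Rightarrow> 'm \<Rightarrow> 'n) module" where
  "hom_mod R Q X Y =
    \<lparr>carrier = rep_hom R Q X Y, monoid.mult = undefined, one = undefined,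
     ring.zero = (\<lambda>i\<in>verts Q. \<lambda>x\<in>carrier (vmod X i). \<zero>\<^bsub>vmod Y i\<^esub>),
     ring.add = (\<lambda>f g. \<lambda>i\<in>verts Q. \<lambda>x\<in>carrier (vmod X i). f i x \<oplus>\<^bsub>vmod Y i\<^esub> g i x),
     module.smult = (\<lambda>r f. \<lambda>i\<in>verts Q. \<lambda>x\<in>carrier (vmod X i). r \<odot>\<^bsub>vmod Y i\<^esub> f i x)\<rparr>"

definition box ::
    "('a, 'r) ring_scheme \<Rightarrow> ('v, 'e) pre_digraph \<Rightarrow> ('v, 'e, 'a, 'm) qrep
      \<Rightarrow> ('v, 'e, 'a, 'n) qrep \<Rightarrow> ('v, 'e, 'a, ('m \<times> 'n \<Rightarrow> 'a) set) qrep" where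
  "box R Q X Y =
    \<lparr>vmod = (\<lambda>i. tensor R (vmod X i) (vmod Y i)),
     amap = (\<lambda>\<alpha>. tensor_map R (vmod X (tail Q \<alpha>)) (vmod Y (tail Q \<alpha>))
                            (vmod X (head Q \<alpha>)) (vmod Y (head Q \<alpha>)) (amap X \<alpha>) (amap Y \<alpha>))\<rparr>"

text \<open>\<open>id\<^sub>X \<box> g : X \<box> Z \<rightarrow> X \<box> Z'\<close> for \<open>g : Z \<rightarrow> Z'\<close>.\<close>

definition box_map ::
    "('a, 'r) ring_scheme \<Rightarrow> ('v, 'e) pre_digraph \<Rightarrow> ('v, 'e, 'a, 'x) qrep
      \<Rightarrow> ('v, 'e, 'a, 'm) qrep \<Rightarrow> ('v, 'e, 'a, 'n) qrep \<Rightarrow> ('v \<Rightarrow> 'm \<Rightarrow> 'n)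
      \<Rightarrow> 'v \<Rightarrow> ('x \<times> 'm \<Rightarrow> 'a) set \<Rightarrow> ('x \<times> 'n \<Rightarrow> 'a) set" where
  "box_map R Q X Z Z' g =
    (\<lambda>i\<in>verts Q. tensor_map R (vmod X i) (vmod Z i) (vmod X i) (vmod Z' i)
        (rep_id Q X i) (g i))"

text \<open>
  A path is the list of its arcs in the order of traversal. Hence the product \<open>\<beta> p\<close> of the
  path algebra (first \<open>p\<close>, then \<open>\<beta>\<close>) is \<open>p @ [\<beta>]\<close>, and \<open>p \<alpha>\<close> is \<open>\<alpha> # p\<close>.
\<close>

definition proj_rep ::
    "('a, 'r) ring_scheme \<Rightarrow> ('v, 'e) pre_digraph \<Rightarrow> 'v \<Rightarrow> ('v, 'e, 'a, 'e list \<Rightarrow> 'a) qrep" where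
  "proj_rep R Q i =
    \<lparr>vmod = (\<lambda>k. free_mod R {p. pre_digraph.awalk Q i p k}),
     amap = (\<lambda>\<beta>. \<lambda>u\<in>carrier (free_mod R {p. pre_digraph.awalk Q i p (tail Q \<beta>)}).
                free_map R (\<lambda>p. p @ [\<beta>]) u)\<rparr>"

definition proj_incl ::
    "('a, 'r) ring_scheme \<Rightarrow> ('v, 'e) pre_digraph \<Rightarrow> 'e \<Rightarrow> 'v \<Rightarrow> ('e list \<Rightarrow> 'a) \<Rightarrow> ('e list \<Rightarrow> 'a)"
  where
  "proj_incl R Q \<alpha> =
    (\<lambda>k\<in>verts Q. \<lambda>u\<in>carrier (vmod (proj_rep R Q (head Q \<alpha>)) k). free_map R (\<lambda>p. \<alpha> # p) u)"

definition internal_hom ::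
    "('a, 'r) ring_scheme \<Rightarrow> ('v, 'e) pre_digraph \<Rightarrow> ('v, 'e, 'a, 'x) qrep
      \<Rightarrow> ('v, 'e, 'a, 'y) qrep
      \<Rightarrow> ('v, 'e, 'a, 'v \<Rightarrow> ('x \<times> ('e list \<Rightarrow> 'a) \<Rightarrow> 'a) set \<Rightarrow> 'y) qrep" where
  "internal_hom R Q X Y =
    \<lparr>vmod = (\<lambda>i. hom_mod R Q (box R Q X (proj_rep R Q i)) Y),
     amap = (\<lambda>\<alpha>. \<lambda>\<phi>\<in>rep_hom R Q (box R Q X (proj_rep R Q (tail Q \<alpha>))) Y.
       rep_comp Q (box R Q X (proj_rep R Q (head Q \<alpha>))) \<phi>
         (box_map R Q X (proj_rep R Q (head Q \<alpha>)) (proj_rep R Q (tail Q \<alpha>))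
           (proj_incl R Q \<alpha>)))\<rparr>"

text \<open>The morphism \<open>internal_hom X Y \<rightarrow> internal_hom X Y'\<close> given by \<open>g \<circ> -\<close> for \<open>g : Y \<rightarrow> Y'\<close>.\<close>

definition internal_hom_map ::
    "('a, 'r) ring_scheme \<Rightarrow> ('v, 'e) pre_digraph \<Rightarrow> ('v, 'e, 'a, 'x) qrep
      \<Rightarrow> ('v, 'e, 'a, 'y) qrep \<Rightarrow> ('v \<Rightarrow> 'y \<Rightarrow> 'y1)
      \<Rightarrow> 'v \<Rightarrow> ('v \<Rightarrow> ('x \<times> ('e list \<Rightarrow> 'a) \<Rightarrow> 'a) set \<Rightarrow> 'y)
      \<Rightarrow> ('v \<Rightarrow> ('x \<times> ('e list \<Rightarrow> 'a) \<Rightarrow> 'a) set \<Rightarrow> 'y1)" where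
  "internal_hom_map R Q X Y g =
    (\<lambda>i\<in>verts Q. \<lambda>\<phi>\<in>rep_hom R Q (box R Q X (proj_rep R Q i)) Y.
       rep_comp Q (box R Q X (proj_rep R Q i)) g \<phi>)"

text \<open>
  The morphism \<open>P(i) \<rightarrow> Z\<close> corresponding to \<open>z \<in> Z\<^sub>i\<close>: a path \<open>p\<close> from \<open>i\<close> to \<open>k\<close> goes to
  \<open>Z\<^sub>p z\<close>, the composite of the structure maps of \<open>Z\<close> along \<open>p\<close> applied to \<open>z\<close>.
\<close>

definition yoneda ::
    "('a, 'r) ring_scheme \<Rightarrow> ('v, 'e) pre_digraph \<Rightarrow> ('v, 'e, 'a, 'm) qrep \<Rightarrow> 'v \<Rightarrow> 'm
      \<Rightarrow> 'v \<Rightarrow> ('e list \<Rightarrow> 'a) \<Rightarrow> 'm" where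
  "yoneda R Q Z i z =
    (\<lambda>k\<in>verts Q. \<lambda>u\<in>carrier (vmod (proj_rep R Q i) k).
      finsum (vmod Z k) (\<lambda>p. u p \<odot>\<^bsub>vmod Z k\<^esub> fold (amap Z) p z) {p. u p \<noteq> \<zero>\<^bsub>R\<^esub>})"

text \<open>
  The adjunction map \<open>Hom (X \<box> Z, Y) \<rightarrow> Hom (Z, internal_hom X Y)\<close>,
  \<open>f \<mapsto> (z \<mapsto> f \<circ> (id\<^sub>X \<box> yoneda z))\<close>. It is given by a formula because a family indexed by
  representations on all carrier types cannot be existentially quantified in HOL.
\<close>

definition transpose_hom ::
    "('a, 'r) ring_scheme \<Rightarrow> ('v, 'e) pre_digraph \<Rightarrow> ('v, 'e, 'a, 'x) qrep
      \<Rightarrow> ('v, 'e, 'a, 'z) qrep \<Rightarrow> ('v \<Rightarrow> ('x \<times> 'z \<Rightarrow> 'a) set \<Rightarrow> 'y)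
      \<Rightarrow> 'v \<Rightarrow> 'z \<Rightarrow> 'v \<Rightarrow> ('x \<times> ('e list \<Rightarrow> 'a) \<Rightarrow> 'a) set \<Rightarrow> 'y" where
  "transpose_hom R Q X Z f =
    (\<lambda>i\<in>verts Q. \<lambda>z\<in>carrier (vmod Z i).
      rep_comp Q (box R Q X (proj_rep R Q i)) f
        (box_map R Q X (proj_rep R Q i) Z (yoneda R Q Z i z)))"

end

theory Submission
  imports Defs
begin

text \<open>
  The representation \<open>P(i)\<close> is free on the paths starting at \<open>i\<close>. By Yoneda, an element \<open>z\<close> of \<open>Z\<^sub>i\<close>
  is the same as a morphism \<open>P(i) \<rightarrow> Z\<close>, namely the one sending a path \<open>p\<close> to \<open>Z\<^sub>p z\<close>. An internal hom
  \<open>H\<close> must therefore satisfy \<open>H\<^sub>i = Hom (P(i), H) = Hom (X \<box> P(i), Y)\<close>, and the work is to show that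
  this formula does give a right adjoint.

  Vertexwise everything reduces to two universal properties: linear maps out of a free module are
  determined by the basis, and linear maps out of a tensor product correspond to bilinear maps. Hence a
  morphism out of \<open>X \<box> Z\<close> is determined by pure tensors \<open>x \<otimes> z\<close> (\<open>box_hom_eqI\<close>), and a morphism out of
  \<open>X \<box> P(i)\<close> by the tensors \<open>x \<otimes> p\<close> with \<open>p\<close> a path starting at \<open>i\<close> (\<open>box_proj_hom_eqI\<close>).

  On such tensors the transpose of \<open>f : X \<box> Z \<rightarrow> Y\<close> is given by \<open>x \<otimes> p \<mapsto> f (x \<otimes> Z\<^sub>p z)\<close>
  (\<open>transpose_hom_pure\<close>), and the structure map of the internal hom along an arrow \<open>\<alpha>\<close> prepends \<open>\<alpha>\<close> to
  the path (\<open>internal_hom_amap_gen\<close>). So the transpose is a morphism of representations. Its inverse sends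
  \<open>g : Z \<rightarrow> H\<close> to the map \<open>x \<otimes> z \<mapsto> g z (x \<otimes> [])\<close> that evaluates at trivial paths. One composite is the
  identity because \<open>Z\<^sub>p\<close> is the identity for \<open>p = []\<close>. The other one is because naturality of \<open>g\<close> along
  a path \<open>p\<close> turns the value of \<open>g (Z\<^sub>p z)\<close> at \<open>x \<otimes> []\<close> into the value of \<open>g z\<close> at \<open>x \<otimes> p\<close>
  (\<open>path_translate\<close>). The naturality and functoriality clauses follow from the same formula and from
  associativity of composition.
\<close>

section \<open>Homomorphisms of modules\<close>

lemma mod_homI:
  assumes "h \<in> carrier M \<rightarrow>\<^sub>E carrier N"
    and "\<And>x y. x \<in> carrier M \<Longrightarrow> y \<in> carrier M \<Longrightarrow> h (x \<oplus>\<^bsub>M\<^esub> y) = h x \<oplus>\<^bsub>N\<^esub> h y"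
    and "\<And>r x. r \<in> carrier R \<Longrightarrow> x \<in> carrier M \<Longrightarrow> h (r \<odot>\<^bsub>M\<^esub> x) = r \<odot>\<^bsub>N\<^esub> h x"
  shows "h \<in> mod_hom R M N"
  using assms by (simp add: mod_hom_def)

lemma
  assumes "h \<in> mod_hom R M N"
  shows mod_hom_PiE: "h \<in> carrier M \<rightarrow>\<^sub>E carrier N"
    and mod_hom_closed: "x \<in> carrier M \<Longrightarrow> h x \<in> carrier N"
    and mod_hom_add: "x \<in> carrier M \<Longrightarrow> y \<in> carrier M \<Longrightarrow> h (x \<oplus>\<^bsub>M\<^esub> y) = h x \<oplus>\<^bsub>N\<^esub> h y"
    and mod_hom_smult: "r \<in> carrier R \<Longrightarrow> x \<in> carrier M \<Longrightarrow> h (r \<odot>\<^bsub>M\<^esub> x) = r \<odot>\<^bsub>N\<^esub> h x"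
  using assms by (auto simp: mod_hom_def)

lemma mod_hom_eqI:
  assumes "h \<in> mod_hom R M N" and "h' \<in> mod_hom R M N'"
    and "\<And>x. x \<in> carrier M \<Longrightarrow> h x = h' x"
  shows "h = h'"
proof (rule extensionalityI)
  show "h \<in> extensional (carrier M)" "h' \<in> extensional (carrier M)"
    using mod_hom_PiE[OF assms(1)] mod_hom_PiE[OF assms(2)] by (auto simp: PiE_iff)
qed (rule assms(3))

lemma mod_hom_zero:
  assumes "module R M" and "module R N" and h: "h \<in> mod_hom R M N"
  shows "h \<zero>\<^bsub>M\<^esub> = \<zero>\<^bsub>N\<^esub>"
proof -
  interpret M: module R M by fact
  interpret N: module R N by fact
  have "h \<zero>\<^bsub>M\<^esub> = h (\<zero>\<^bsub>R\<^esub> \<odot>\<^bsub>M\<^esub> \<zero>\<^bsub>M\<^esub>)" by simp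
  also have "\<dots> = \<zero>\<^bsub>R\<^esub> \<odot>\<^bsub>N\<^esub> h \<zero>\<^bsub>M\<^esub>" by (rule mod_hom_smult[OF h]) simp_all
  also have "\<dots> = \<zero>\<^bsub>N\<^esub>" by (rule N.smult_l_null) (simp add: mod_hom_closed[OF h])
  finally show ?thesis .
qed

lemma mod_hom_compose:
  assumes "module R M" and "g \<in> mod_hom R M N" and "h \<in> mod_hom R N L"
  shows "compose (carrier M) h g \<in> mod_hom R M L"
proof -
  interpret M: module R M by fact
  show ?thesis
    using assms(2,3) by (intro mod_homI) (auto simp: compose_def mod_hom_closed mod_hom_add mod_hom_smult)
qed

lemma mod_hom_id:
  assumes "module R M"
  shows "(\<lambda>x\<in>carrier M. x) \<in> mod_hom R M M"
proof -
  interpret M: module R M by fact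
  show ?thesis by (intro mod_homI) auto
qed


section \<open>Free modules\<close>

lemma free_mod_simps:
  "u \<in> carrier (free_mod R S) \<longleftrightarrow> (\<forall>s. u s \<in> carrier R) \<and> (\<forall>s. s \<notin> S \<longrightarrow> u s = \<zero>\<^bsub>R\<^esub>) \<and>
     finite {s. u s \<noteq> \<zero>\<^bsub>R\<^esub>}"
  "\<zero>\<^bsub>free_mod R S\<^esub> = (\<lambda>s. \<zero>\<^bsub>R\<^esub>)"
  "u \<oplus>\<^bsub>free_mod R S\<^esub> w = (\<lambda>s. u s \<oplus>\<^bsub>R\<^esub> w s)"
  "r \<odot>\<^bsub>free_mod R S\<^esub> u = (\<lambda>s. r \<otimes>\<^bsub>R\<^esub> u s)"
  by (simp_all add: free_mod_def)

context
  notes free_mod_simps [simp]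
begin

lemma free_mod_module:
  fixes R (structure)
  assumes "cring R"
  shows "module R (free_mod R S)"
proof -
  interpret cring R by fact
  have add: "finite {s. u s \<oplus> w s \<noteq> \<zero>}"
    if "finite {s. u s \<noteq> \<zero>}" "finite {s. w s \<noteq> \<zero>}" for u w :: "_ \<Rightarrow> _"
    by (rule finite_subset[OF _ finite_UnI[OF that]]) auto
  have mult: "finite {s. r \<otimes> u s \<noteq> \<zero>}" if "finite {s. u s \<noteq> \<zero>}" "r \<in> carrier R" for r u
    by (rule finite_subset[OF _ that(1)]) (use that(2) in auto)
  have neg: "finite {s. \<ominus> u s \<noteq> \<zero>}" if "finite {s. u s \<noteq> \<zero>}" for u :: "_ \<Rightarrow> _"
    by (rule finite_subset[OF _ that(1)]) auto
  show ?thesis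
  proof (rule moduleI[OF assms])
    show "abelian_group (free_mod R S)"
    proof (rule abelian_groupI)
      fix u assume u: "u \<in> carrier (free_mod R S)"
      show "\<exists>w\<in>carrier (free_mod R S). w \<oplus>\<^bsub>free_mod R S\<^esub> u = \<zero>\<^bsub>free_mod R S\<^esub>"
        by (rule bexI[of _ "\<lambda>s. \<ominus> u s"]) (use u in \<open>simp_all add: l_neg neg\<close>)
    qed (auto simp: a_ac add)
  qed (auto simp: mult l_distr r_distr m_assoc)
qed

lemma free_gen_carrier [simp]:
  assumes "cring R" and "s \<in> S"
  shows "free_gen R s \<in> carrier (free_mod R S)"
proof -
  interpret cring R by fact
  have "finite {t. free_gen R s t \<noteq> \<zero>\<^bsub>R\<^esub>}"
    by (rule finite_subset[of _ "{s}"]) (auto simp: free_gen_def)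
  then show ?thesis using assms(2) by (auto simp: free_gen_def)
qed

text \<open>
  Splitting off one basis vector at a time, by induction on the size of the support, shows that a
  property closed under the module operations holds everywhere once it holds on the basis.
\<close>

lemma free_mod_induct [consumes 2, case_names zero gen add smult]:
  assumes "cring R" and u: "u \<in> carrier (free_mod R S)"
    and zero: "P \<zero>\<^bsub>free_mod R S\<^esub>"
    and gen: "\<And>s. s \<in> S \<Longrightarrow> P (free_gen R s)"
    and add: "\<And>u w. u \<in> carrier (free_mod R S) \<Longrightarrow> w \<in> carrier (free_mod R S) \<Longrightarrow>
        P u \<Longrightarrow> P w \<Longrightarrow> P (u \<oplus>\<^bsub>free_mod R S\<^esub> w)"
    and smult: "\<And>r u. r \<in> carrier R \<Longrightarrow> u \<in> carrier (free_mod R S) \<Longrightarrow> P u \<Longrightarrow>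
        P (r \<odot>\<^bsub>free_mod R S\<^esub> u)"
  shows "P u"
proof -
  interpret cring R by fact
  interpret F: module R "free_mod R S" by (rule free_mod_module) fact
  have "finite A \<Longrightarrow> u \<in> carrier (free_mod R S) \<Longrightarrow> {s. u s \<noteq> \<zero>\<^bsub>R\<^esub>} = A \<Longrightarrow> P u" for A u
  proof (induction A arbitrary: u rule: finite_induct)
    case empty
    then have "u = \<zero>\<^bsub>free_mod R S\<^esub>" by auto
    with zero show ?case by simp
  next
    case (insert s A)
    have "{t. (u(s := \<zero>\<^bsub>R\<^esub>)) t \<noteq> \<zero>\<^bsub>R\<^esub>} = A"
      using insert.prems insert.hyps by auto
    moreover from this have w: "u(s := \<zero>\<^bsub>R\<^esub>) \<in> carrier (free_mod R S)"
      using insert.prems(1) insert.hyps(1) by simp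
    ultimately have Pw: "P (u(s := \<zero>\<^bsub>R\<^esub>))" using insert.IH by blast
    have s: "s \<in> S" "u s \<in> carrier R" using insert.prems by auto
    have "u = u(s := \<zero>\<^bsub>R\<^esub>) \<oplus>\<^bsub>free_mod R S\<^esub> u s \<odot>\<^bsub>free_mod R S\<^esub> free_gen R s"
      using insert.prems(1) by (auto simp: free_gen_def fun_eq_iff)
    moreover have "P \<dots>"
      by (intro add smult gen Pw w s F.smult_closed free_gen_carrier \<open>cring R\<close>)
    ultimately show ?case by metis
  qed
  from this[OF _ u refl] u show ?thesis by simp
qed

text \<open>
  The value at \<open>u\<close> of the linear extension of the map \<open>h\<close> on the basis. The Yoneda map and the maps
  induced on free modules and tensor products are all of this shape.
\<close>

definition lin_ext :: "('a, 'r) ring_scheme \<Rightarrow> ('a, 'm) module \<Rightarrow> ('s \<Rightarrow> 'm) \<Rightarrow> ('s \<Rightarrow> 'a) \<Rightarrow> 'm" where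
  "lin_ext R M h u = finsum M (\<lambda>s. u s \<odot>\<^bsub>M\<^esub> h s) {s. u s \<noteq> \<zero>\<^bsub>R\<^esub>}"

lemma lin_ext_superset:
  assumes "module R M" and "u \<in> carrier (free_mod R S)" and h: "h \<in> S \<rightarrow> carrier M"
    and "finite A" and "{s. u s \<noteq> \<zero>\<^bsub>R\<^esub>} \<subseteq> A" and "A \<subseteq> S"
  shows "lin_ext R M h u = finsum M (\<lambda>s. u s \<odot>\<^bsub>M\<^esub> h s) A"
proof -
  interpret M: module R M by fact
  show ?thesis unfolding lin_ext_def
    using assms(2-) by (intro M.add.finprod_mono_neutral_cong_left) (auto intro!: M.smult_closed M.smult_l_null)
qed

lemma lin_ext_mod_hom:
  assumes "module R M" and h: "h \<in> S \<rightarrow> carrier M"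
  shows "(\<lambda>u\<in>carrier (free_mod R S). lin_ext R M h u) \<in> mod_hom R (free_mod R S) M"
proof -
  interpret M: module R M by fact
  interpret F: module R "free_mod R S" by (rule free_mod_module) (rule M.is_cring)
  have supp: "{s. u s \<noteq> \<zero>\<^bsub>R\<^esub>} \<subseteq> S" if "u \<in> carrier (free_mod R S)" for u
    using that by auto
  have fin: "finite {s. u s \<noteq> \<zero>\<^bsub>R\<^esub>}" if "u \<in> carrier (free_mod R S)" for u
    using that by auto
  have val: "u s \<odot>\<^bsub>M\<^esub> h s \<in> carrier M" if "u \<in> carrier (free_mod R S)" "s \<in> S" for u s
    using that h by auto
  have closed: "lin_ext R M h u \<in> carrier M" if "u \<in> carrier (free_mod R S)" for u
    unfolding lin_ext_def by (rule M.finsum_closed) (use val[OF that] supp[OF that] in auto)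
  show ?thesis
  proof (rule mod_homI)
    show "(\<lambda>u\<in>carrier (free_mod R S). lin_ext R M h u) \<in> carrier (free_mod R S) \<rightarrow>\<^sub>E carrier M"
      using closed by (simp add: restrict_PiE_iff)
  next
    fix u w assume uw: "u \<in> carrier (free_mod R S)" "w \<in> carrier (free_mod R S)"
    let ?A = "{s. u s \<noteq> \<zero>\<^bsub>R\<^esub>} \<union> {s. w s \<noteq> \<zero>\<^bsub>R\<^esub>}"
    have A: "finite ?A" "?A \<subseteq> S" using fin supp uw by auto
    have sum: "u \<oplus>\<^bsub>free_mod R S\<^esub> w \<in> carrier (free_mod R S)" using uw by (rule F.add.m_closed)
    have "{s. (u \<oplus>\<^bsub>free_mod R S\<^esub> w) s \<noteq> \<zero>\<^bsub>R\<^esub>} \<subseteq> ?A" by auto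
    then have "lin_ext R M h (u \<oplus>\<^bsub>free_mod R S\<^esub> w)
        = finsum M (\<lambda>s. (u \<oplus>\<^bsub>free_mod R S\<^esub> w) s \<odot>\<^bsub>M\<^esub> h s) ?A"
      by (intro lin_ext_superset[OF assms(1) sum h] A)
    also have "\<dots> = finsum M (\<lambda>s. u s \<odot>\<^bsub>M\<^esub> h s \<oplus>\<^bsub>M\<^esub> w s \<odot>\<^bsub>M\<^esub> h s) ?A"
      using uw h A(2) val by (intro M.finsum_cong') (auto intro!: M.smult_l_distr)
    also have "\<dots> = finsum M (\<lambda>s. u s \<odot>\<^bsub>M\<^esub> h s) ?A \<oplus>\<^bsub>M\<^esub> finsum M (\<lambda>s. w s \<odot>\<^bsub>M\<^esub> h s) ?A"
      using uw A(2) val by (intro M.finsum_addf) auto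
    also have "\<dots> = lin_ext R M h u \<oplus>\<^bsub>M\<^esub> lin_ext R M h w"
      using uw A h assms(1) by (subst (1 2) lin_ext_superset[where A = ?A and S = S]) auto
    finally show "(\<lambda>u\<in>carrier (free_mod R S). lin_ext R M h u) (u \<oplus>\<^bsub>free_mod R S\<^esub> w)
        = (\<lambda>u\<in>carrier (free_mod R S). lin_ext R M h u) u
          \<oplus>\<^bsub>M\<^esub> (\<lambda>u\<in>carrier (free_mod R S). lin_ext R M h u) w"
      using uw sum by (simp only: restrict_apply') 
  next
    fix r u assume ru: "r \<in> carrier R" "u \<in> carrier (free_mod R S)"
    let ?A = "{s. u s \<noteq> \<zero>\<^bsub>R\<^esub>}"
    have A: "finite ?A" "?A \<subseteq> S" using fin supp ru by auto
    have mult: "r \<odot>\<^bsub>free_mod R S\<^esub> u \<in> carrier (free_mod R S)" using ru by (rule F.smult_closed)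
    have "{s. (r \<odot>\<^bsub>free_mod R S\<^esub> u) s \<noteq> \<zero>\<^bsub>R\<^esub>} \<subseteq> ?A" using ru by auto
    then have "lin_ext R M h (r \<odot>\<^bsub>free_mod R S\<^esub> u)
        = finsum M (\<lambda>s. (r \<odot>\<^bsub>free_mod R S\<^esub> u) s \<odot>\<^bsub>M\<^esub> h s) ?A"
      by (intro lin_ext_superset[OF assms(1) mult h] A)
    also have "\<dots> = finsum M (\<lambda>s. r \<odot>\<^bsub>M\<^esub> (u s \<odot>\<^bsub>M\<^esub> h s)) ?A"
      using ru h A(2) by (intro M.finsum_cong') (auto intro!: M.smult_assoc1 M.smult_closed)
    also have "\<dots> = r \<odot>\<^bsub>M\<^esub> lin_ext R M h u"
      unfolding lin_ext_def using ru A h by (intro M.finsum_smult_ldistr[symmetric]) auto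
    finally show "(\<lambda>u\<in>carrier (free_mod R S). lin_ext R M h u) (r \<odot>\<^bsub>free_mod R S\<^esub> u)
        = r \<odot>\<^bsub>M\<^esub> (\<lambda>u\<in>carrier (free_mod R S). lin_ext R M h u) u"
      using ru mult by (simp only: restrict_apply')
  qed
qed

lemma lin_ext_gen:
  assumes "module R M" and h: "h \<in> S \<rightarrow> carrier M" and "s \<in> S"
  shows "lin_ext R M h (free_gen R s) = h s"
proof -
  interpret M: module R M by fact
  \<comment> \<open>Summing over \<open>{s}\<close> instead of the support also covers the zero ring, where the support is empty.\<close>
  have "lin_ext R M h (free_gen R s) = finsum M (\<lambda>t. free_gen R s t \<odot>\<^bsub>M\<^esub> h t) {s}"
    using assms by (intro lin_ext_superset[where S = S] free_gen_carrier M.is_cring) (auto simp: free_gen_def)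
  also have "\<dots> = h s" using assms(3) h by (simp add: free_gen_def Pi_iff)
  finally show ?thesis .
qed

lemma free_mod_hom_eqI:
  assumes "module R M" and g: "g \<in> mod_hom R (free_mod R S) M" and h: "h \<in> mod_hom R (free_mod R S) M"
    and "\<And>s. s \<in> S \<Longrightarrow> g (free_gen R s) = h (free_gen R s)"
  shows "g = h"
proof (rule mod_hom_eqI[OF g h])
  interpret M: module R M by fact
  fix u assume "u \<in> carrier (free_mod R S)"
  with M.is_cring show "g u = h u"
  proof (induction rule: free_mod_induct)
    case zero
    show ?case using mod_hom_zero[OF free_mod_module assms(1) g] mod_hom_zero[OF free_mod_module assms(1) h]
      M.is_cring by simp
  qed (simp_all only: assms(4) mod_hom_add[OF g] mod_hom_add[OF h] mod_hom_smult[OF g] mod_hom_smult[OF h])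
qed

lemma free_mod_finsum_apply:
  assumes "cring R" and "finite A" and "g \<in> A \<rightarrow> carrier (free_mod R S)"
  shows "finsum (free_mod R S) g A t = finsum R (\<lambda>a. g a t) A"
proof -
  interpret cring R by fact
  interpret F: module R "free_mod R S" by (rule free_mod_module) fact
  show ?thesis using assms(2,3)
  proof (induction A rule: finite_induct)
    case (insert a A)
    then show ?case by (simp add: Pi_iff)
  qed simp
qed

text \<open>
  Presenting \<open>free_map\<close> as a linear extension gives its linearity without a new computation.
\<close>

lemma free_map_eq_lin_ext:
  assumes "cring R" and u: "u \<in> carrier (free_mod R S)" and f: "f \<in> S \<rightarrow> T"
  shows "free_map R f u = lin_ext R (free_mod R T) (\<lambda>s. free_gen R (f s)) u"
proof
  interpret cring R by fact
  interpret F: module R "free_mod R T" by (rule free_mod_module) fact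
  fix t
  let ?A = "{s. u s \<noteq> \<zero>\<^bsub>R\<^esub>}"
  have g: "(\<lambda>s. u s \<odot>\<^bsub>free_mod R T\<^esub> free_gen R (f s)) \<in> ?A \<rightarrow> carrier (free_mod R T)"
  proof (intro Pi_I F.smult_closed free_gen_carrier)
    show "cring R" by fact
  qed (use u f in auto)
  have fin: "finite ?A" using u by simp
  have "lin_ext R (free_mod R T) (\<lambda>s. free_gen R (f s)) u t
      = finsum R (\<lambda>s. (u s \<odot>\<^bsub>free_mod R T\<^esub> free_gen R (f s)) t) ?A"
    unfolding lin_ext_def by (rule free_mod_finsum_apply[OF assms(1) fin g])
  also have "\<dots> = finsum R u {s. u s \<noteq> \<zero>\<^bsub>R\<^esub> \<and> f s = t}"
    using u fin by (intro add.finprod_mono_neutral_cong_right) (auto simp: free_gen_def)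
  finally show "free_map R f u t = lin_ext R (free_mod R T) (\<lambda>s. free_gen R (f s)) u t"
    by (simp add: free_map_def)
qed

lemma free_map_mod_hom:
  assumes "cring R" and f: "f \<in> S \<rightarrow> T"
  shows "(\<lambda>u\<in>carrier (free_mod R S). free_map R f u) \<in> mod_hom R (free_mod R S) (free_mod R T)"
proof -
  have "(\<lambda>u\<in>carrier (free_mod R S). free_map R f u)
      = (\<lambda>u\<in>carrier (free_mod R S). lin_ext R (free_mod R T) (\<lambda>s. free_gen R (f s)) u)"
    using assms by (intro restrict_ext free_map_eq_lin_ext) 
  also have "\<dots> \<in> mod_hom R (free_mod R S) (free_mod R T)"
    using assms by (intro lin_ext_mod_hom free_mod_module) (auto intro!: free_gen_carrier simp del: free_mod_simps)
  finally show ?thesis .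
qed

lemma free_map_gen:
  assumes "cring R" and "f \<in> S \<rightarrow> T" and "s \<in> S"
  shows "free_map R f (free_gen R s) = free_gen R (f s)"
  using assms
  by (subst free_map_eq_lin_ext[where S = S and T = T])
    (auto intro!: lin_ext_gen[where S = S] free_mod_module free_gen_carrier simp del: free_mod_simps)

end


section \<open>Quotient modules\<close>

lemma submodule_span_submodule:
  assumes "module R M" and "S \<subseteq> carrier M"
  shows "submodule (submodule_span R M S) R M"
proof -
  interpret M: module R M by fact
  have "carrier M \<in> {H. submodule H R M \<and> S \<subseteq> H}"
    using M.carrier_is_submodule assms(2) by simp
  then show ?thesis
    unfolding submodule_span_def
    by (intro M.submoduleI)
      (auto dest: M.submoduleE(3-5) intro: M.submoduleE subgroup.one_closed[OF submodule.axioms(1), simplified])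
qed

lemma submodule_span_superset: "S \<subseteq> submodule_span R M S"
  by (auto simp: submodule_span_def)

lemma submodule_span_least: "submodule H R M \<Longrightarrow> S \<subseteq> H \<Longrightarrow> submodule_span R M S \<subseteq> H"
  by (auto simp: submodule_span_def)

lemma mod_hom_kernel_submodule:
  assumes "module R M" and "module R N" and h: "h \<in> mod_hom R M N"
  shows "submodule {x \<in> carrier M. h x = \<zero>\<^bsub>N\<^esub>} R M"
proof -
  interpret M: module R M by fact
  interpret N: module R N by fact
  have neg: "h (\<ominus>\<^bsub>M\<^esub> x) = \<zero>\<^bsub>N\<^esub>" if "x \<in> carrier M" "h x = \<zero>\<^bsub>N\<^esub>" for x
  proof -
    have "\<ominus>\<^bsub>M\<^esub> x = (\<ominus>\<^bsub>R\<^esub> \<one>\<^bsub>R\<^esub>) \<odot>\<^bsub>M\<^esub> x" using that by (simp add: M.smult_l_minus)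
    then show ?thesis using that by (simp add: mod_hom_smult[OF h])
  qed
  show ?thesis
    by (rule M.submoduleI)
      (auto simp: neg mod_hom_zero[OF assms] mod_hom_add[OF h] mod_hom_smult[OF h])
qed

lemma submodule_abelian_subgroup:
  assumes "module R M" and "submodule H R M"
  shows "abelian_subgroup H M"
proof -
  interpret M: module R M by fact
  show ?thesis
    by (rule abelian_subgroupI3) (auto intro: additive_subgroup.intro submodule.axioms(1)[OF assms(2)] M.abelian_group_axioms)
qed

lemma quot_mod_simps:
  "carrier (quot_mod M H) = a_rcosets\<^bsub>M\<^esub> H"
  "\<zero>\<^bsub>quot_mod M H\<^esub> = H"
  "C \<oplus>\<^bsub>quot_mod M H\<^esub> D = C <+>\<^bsub>M\<^esub> D"
  "r \<odot>\<^bsub>quot_mod M H\<^esub> C = (\<Union>x\<in>C. H +>\<^bsub>M\<^esub> (r \<odot>\<^bsub>M\<^esub> x))"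
  by (simp_all add: quot_mod_def)

context
  fixes R :: "('a, 'r) ring_scheme" and M :: "('a, 'm) module" and H :: "'m set"
  assumes mod: "module R M" and sub: "submodule H R M"
begin

interpretation M: module R M by (rule mod)
interpretation H: abelian_subgroup H M by (rule submodule_abelian_subgroup[OF mod sub])

lemma coset_eqI:
  assumes "x \<in> carrier M" and "y \<in> carrier M" and "x \<ominus>\<^bsub>M\<^esub> y \<in> H"
  shows "H +>\<^bsub>M\<^esub> x = H +>\<^bsub>M\<^esub> y"
  using assms(3) H.a_rcos_module[OF assms(2,1)] H.a_repr_independence'[OF _ assms(2)]
  by (simp add: M.minus_eq)

lemma quot_mod_carrier: "C \<in> carrier (quot_mod M H) \<longleftrightarrow> (\<exists>x\<in>carrier M. C = H +>\<^bsub>M\<^esub> x)"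
  by (auto simp: quot_mod_simps A_RCOSETS_def')

lemma quot_mod_cases:
  assumes "C \<in> carrier (quot_mod M H)"
  obtains x where "x \<in> carrier M" and "C = H +>\<^bsub>M\<^esub> x"
  using assms by (auto simp: quot_mod_carrier)

lemma coset_carrier: "x \<in> carrier M \<Longrightarrow> H +>\<^bsub>M\<^esub> x \<in> carrier (quot_mod M H)"
  by (auto simp: quot_mod_carrier)

lemma quot_mod_add:
  assumes "x \<in> carrier M" and "y \<in> carrier M"
  shows "(H +>\<^bsub>M\<^esub> x) \<oplus>\<^bsub>quot_mod M H\<^esub> (H +>\<^bsub>M\<^esub> y) = H +>\<^bsub>M\<^esub> (x \<oplus>\<^bsub>M\<^esub> y)"
  using assms by (simp add: quot_mod_simps H.a_rcos_sum)

lemma coset_mem_carrier: "x \<in> carrier M \<Longrightarrow> y \<in> H +>\<^bsub>M\<^esub> x \<Longrightarrow> y \<in> carrier M"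
  using H.a_elemrcos_carrier by blast

text \<open>
  Scalar multiplication on a quotient and the map \<open>f \<otimes> g\<close> are unions over all representatives of a coset.
  Such a union collapses as soon as the summand is independent of the representative.
\<close>

lemma coset_const_UNION:
  assumes "x \<in> carrier M" and "\<And>y. y \<in> H +>\<^bsub>M\<^esub> x \<Longrightarrow> F y = F x"
  shows "(\<Union>y\<in>H +>\<^bsub>M\<^esub> x. F y) = F x"
  using assms H.a_rcos_self by blast

lemma quot_mod_smult:
  assumes "r \<in> carrier R" and x: "x \<in> carrier M"
  shows "r \<odot>\<^bsub>quot_mod M H\<^esub> (H +>\<^bsub>M\<^esub> x) = H +>\<^bsub>M\<^esub> (r \<odot>\<^bsub>M\<^esub> x)"
  unfolding quot_mod_simps
proof (rule coset_const_UNION[OF x])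
  fix y assume y: "y \<in> H +>\<^bsub>M\<^esub> x"
  then obtain h where h: "h \<in> H" "y = h \<oplus>\<^bsub>M\<^esub> x" by (auto simp: a_r_coset_def')
  have "r \<odot>\<^bsub>M\<^esub> y = r \<odot>\<^bsub>M\<^esub> h \<oplus>\<^bsub>M\<^esub> r \<odot>\<^bsub>M\<^esub> x"
    using h assms by (simp add: M.smult_r_distr)
  then have "r \<odot>\<^bsub>M\<^esub> y \<in> H +>\<^bsub>M\<^esub> (r \<odot>\<^bsub>M\<^esub> x)"
    using h assms submodule.smult_closed[OF sub] by (auto simp: a_r_coset_def')
  then show "H +>\<^bsub>M\<^esub> (r \<odot>\<^bsub>M\<^esub> y) = H +>\<^bsub>M\<^esub> (r \<odot>\<^bsub>M\<^esub> x)"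
    using H.a_repr_independence' assms by (metis M.smult_closed)
qed

lemma quot_mod_zero: "\<zero>\<^bsub>quot_mod M H\<^esub> = H +>\<^bsub>M\<^esub> \<zero>\<^bsub>M\<^esub>"
  by (simp add: quot_mod_simps H.a_rcos_const)

lemma quot_mod_module: "module R (quot_mod M H)"
proof (rule moduleI)
  show "cring R" by (rule M.is_cring)
  show "abelian_group (quot_mod M H)"
  proof (rule abelian_groupI)
    fix C assume "C \<in> carrier (quot_mod M H)"
    then obtain x where x: "x \<in> carrier M" "C = H +>\<^bsub>M\<^esub> x" by (rule quot_mod_cases)
    then have "(H +>\<^bsub>M\<^esub> (\<ominus>\<^bsub>M\<^esub> x)) \<oplus>\<^bsub>quot_mod M H\<^esub> C = \<zero>\<^bsub>quot_mod M H\<^esub>"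
      by (simp add: quot_mod_add quot_mod_zero M.l_neg)
    then show "\<exists>D\<in>carrier (quot_mod M H). D \<oplus>\<^bsub>quot_mod M H\<^esub> C = \<zero>\<^bsub>quot_mod M H\<^esub>"
      using coset_carrier[OF M.a_inv_closed[OF x(1)]] by blast
  qed ((elim quot_mod_cases)?, simp add: coset_carrier quot_mod_add quot_mod_zero M.a_ac)+
qed (elim quot_mod_cases, simp add: coset_carrier quot_mod_add quot_mod_smult M.smult_l_distr
    M.smult_r_distr M.smult_assoc1)+

lemma quot_mod_proj_hom: "(\<lambda>x\<in>carrier M. H +>\<^bsub>M\<^esub> x) \<in> mod_hom R M (quot_mod M H)"
  by (intro mod_homI) (simp_all add: restrict_PiE_iff coset_carrier quot_mod_add quot_mod_smult)

lemma mod_hom_coset_const: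
  assumes "module R N" and h: "h \<in> mod_hom R M N" and "\<And>x. x \<in> H \<Longrightarrow> h x = \<zero>\<^bsub>N\<^esub>"
    and x: "x \<in> carrier M" and y: "y \<in> H +>\<^bsub>M\<^esub> x"
  shows "h y = h x"
proof -
  interpret N: module R N by fact
  obtain z where z: "z \<in> H" "y = z \<oplus>\<^bsub>M\<^esub> x" using y by (auto simp: a_r_coset_def')
  then have "h y = h z \<oplus>\<^bsub>N\<^esub> h x" using x by (simp add: mod_hom_add[OF h])
  with z assms(3) x show ?thesis by (simp add: mod_hom_closed[OF h])
qed

lemma quot_mod_homI:
  assumes h: "h \<in> mod_hom R M N" and "k \<in> extensional (carrier (quot_mod M H))"
    and k: "\<And>x. x \<in> carrier M \<Longrightarrow> k (H +>\<^bsub>M\<^esub> x) = h x"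
  shows "k \<in> mod_hom R (quot_mod M H) N"
proof (rule mod_homI)
  show "k \<in> carrier (quot_mod M H) \<rightarrow>\<^sub>E carrier N"
    using assms(2) by (auto simp: PiE_iff k mod_hom_closed[OF h] elim!: quot_mod_cases)
qed (elim quot_mod_cases, simp add: quot_mod_add quot_mod_smult k mod_hom_add[OF h] mod_hom_smult[OF h])+

end


section \<open>Tensor products of modules\<close>

text \<open>The coset \<open>x \<otimes> y\<close>.\<close>

definition pure_tensor ::
    "('a, 'r) ring_scheme \<Rightarrow> ('a, 'm) module \<Rightarrow> ('a, 'n) module \<Rightarrow> 'm \<Rightarrow> 'n \<Rightarrow> ('m \<times> 'n \<Rightarrow> 'a) set" where
  "pure_tensor R M N x y =
    tensor_ker R M N +>\<^bsub>free_mod R (carrier M \<times> carrier N)\<^esub> free_gen R (x, y)"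

definition bilinear_map ::
    "('a, 'r) ring_scheme \<Rightarrow> ('a, 'm) module \<Rightarrow> ('a, 'n) module \<Rightarrow> ('a, 'l) module
      \<Rightarrow> ('m \<Rightarrow> 'n \<Rightarrow> 'l) \<Rightarrow> bool" where
  "bilinear_map R M N L b \<longleftrightarrow>
    (\<forall>x\<in>carrier M. \<forall>y\<in>carrier N. b x y \<in> carrier L) \<and>
    (\<forall>x\<in>carrier M. \<forall>x'\<in>carrier M. \<forall>y\<in>carrier N. b (x \<oplus>\<^bsub>M\<^esub> x') y = b x y \<oplus>\<^bsub>L\<^esub> b x' y) \<and>
    (\<forall>x\<in>carrier M. \<forall>y\<in>carrier N. \<forall>y'\<in>carrier N. b x (y \<oplus>\<^bsub>N\<^esub> y') = b x y \<oplus>\<^bsub>L\<^esub> b x y') \<and>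
    (\<forall>r\<in>carrier R. \<forall>x\<in>carrier M. \<forall>y\<in>carrier N. b (r \<odot>\<^bsub>M\<^esub> x) y = r \<odot>\<^bsub>L\<^esub> b x y) \<and>
    (\<forall>r\<in>carrier R. \<forall>x\<in>carrier M. \<forall>y\<in>carrier N. b x (r \<odot>\<^bsub>N\<^esub> y) = r \<odot>\<^bsub>L\<^esub> b x y)"

lemma bilinear_map_cong:
  assumes M: "module R M" and N: "module R N" and "bilinear_map R M N L b"
    and "\<And>x y. x \<in> carrier M \<Longrightarrow> y \<in> carrier N \<Longrightarrow> b' x y = b x y"
  shows "bilinear_map R M N L b'"
proof -
  interpret M: module R M by fact
  interpret N: module R N by fact
  show ?thesis using assms(3,4) by (simp add: bilinear_map_def)
qed

lemma bilinear_map_compose: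
  assumes "bilinear_map R M' N' L b" and f: "f \<in> mod_hom R M M'" and g: "g \<in> mod_hom R N N'"
  shows "bilinear_map R M N L (\<lambda>x y. b (f x) (g y))"
  using assms(1)
  by (simp add: bilinear_map_def mod_hom_closed[OF f] mod_hom_closed[OF g]
    mod_hom_add[OF f] mod_hom_add[OF g] mod_hom_smult[OF f] mod_hom_smult[OF g])

context
  fixes R :: "('a, 'r) ring_scheme" and M :: "('a, 'm) module" and N :: "('a, 'n) module"
  assumes M: "module R M" and N: "module R N"
begin

interpretation M: module R M by (rule M)
interpretation N: module R N by (rule N)

private abbreviation (input) F where "F \<equiv> free_mod R (carrier M \<times> carrier N)"

lemma free_mod_prod_module: "module R F"
  by (rule free_mod_module) (rule M.is_cring)

interpretation F: module R F by (rule free_mod_prod_module)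

lemma gen_carrier: "x \<in> carrier M \<Longrightarrow> y \<in> carrier N \<Longrightarrow> free_gen R (x, y) \<in> carrier F"
  by (intro free_gen_carrier M.is_cring) simp

lemma tensor_rels_carrier: "tensor_rels R M N \<subseteq> carrier F"
  unfolding tensor_rels_def Let_def
  by (intro subsetI, elim UnE CollectE exE conjE) (simp_all add: gen_carrier)

lemma tensor_ker_submodule: "submodule (tensor_ker R M N) R F"
  unfolding tensor_ker_def by (rule submodule_span_submodule[OF free_mod_prod_module tensor_rels_carrier])

lemma tensor_rels_ker: "tensor_rels R M N \<subseteq> tensor_ker R M N"
  unfolding tensor_ker_def by (rule submodule_span_superset)

lemmas tensor_coset_eqI = coset_eqI[OF free_mod_prod_module tensor_ker_submodule]
lemmas tensor_add = quot_mod_add[OF free_mod_prod_module tensor_ker_submodule, folded tensor_def]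
lemmas tensor_smult = quot_mod_smult[OF free_mod_prod_module tensor_ker_submodule, folded tensor_def]
lemmas tensor_carrier = quot_mod_carrier[OF free_mod_prod_module tensor_ker_submodule, folded tensor_def]

lemmas tensor_coset_carrier = coset_carrier[OF free_mod_prod_module tensor_ker_submodule, folded tensor_def]

lemma tensor_module: "module R (tensor R M N)"
  unfolding tensor_def by (rule quot_mod_module[OF free_mod_prod_module tensor_ker_submodule])

text \<open>
  The coset of a generator depends bilinearly on it because the four laws, read as differences, are
  exactly the four families of relations.
\<close>

lemma pure_tensor_bilinear: "bilinear_map R M N (tensor R M N) (pure_tensor R M N)"
proof -
  let ?K = "\<lambda>u. tensor_ker R M N +>\<^bsub>F\<^esub> u" and ?d = "\<lambda>x y. free_gen R (x, y)"
  have eq: "?K u = ?K w" if "u \<ominus>\<^bsub>F\<^esub> w \<in> tensor_rels R M N" "u \<in> carrier F" "w \<in> carrier F" for u w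
    using that tensor_rels_ker by (intro tensor_coset_eqI subsetD[OF tensor_rels_ker])
  have sum: "?K u \<oplus>\<^bsub>tensor R M N\<^esub> ?K w = ?K (u \<oplus>\<^bsub>F\<^esub> w)" if "u \<in> carrier F" "w \<in> carrier F" for u w
    using that by (rule tensor_add)
  have mult: "r \<odot>\<^bsub>tensor R M N\<^esub> ?K u = ?K (r \<odot>\<^bsub>F\<^esub> u)" if "r \<in> carrier R" "u \<in> carrier F" for r u
    using that by (rule tensor_smult)
  have rels: "?d (x \<oplus>\<^bsub>M\<^esub> x') y \<ominus>\<^bsub>F\<^esub> (?d x y \<oplus>\<^bsub>F\<^esub> ?d x' y) \<in> tensor_rels R M N"
    if "x \<in> carrier M" "x' \<in> carrier M" "y \<in> carrier N" for x x' y
    unfolding tensor_rels_def Let_def by (rule UnI1, rule UnI1, rule UnI1) (use that in blast)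
  have rels': "?d x (y \<oplus>\<^bsub>N\<^esub> y') \<ominus>\<^bsub>F\<^esub> (?d x y \<oplus>\<^bsub>F\<^esub> ?d x y') \<in> tensor_rels R M N"
    if "x \<in> carrier M" "y \<in> carrier N" "y' \<in> carrier N" for x y y'
    unfolding tensor_rels_def Let_def by (rule UnI1, rule UnI1, rule UnI2) (use that in blast)
  have rels_smult: "?d (r \<odot>\<^bsub>M\<^esub> x) y \<ominus>\<^bsub>F\<^esub> (r \<odot>\<^bsub>F\<^esub> ?d x y) \<in> tensor_rels R M N"
    if "r \<in> carrier R" "x \<in> carrier M" "y \<in> carrier N" for r x y
    unfolding tensor_rels_def Let_def by (rule UnI1, rule UnI2) (use that in blast)
  have rels_smult': "?d x (r \<odot>\<^bsub>N\<^esub> y) \<ominus>\<^bsub>F\<^esub> (r \<odot>\<^bsub>F\<^esub> ?d x y) \<in> tensor_rels R M N"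
    if "r \<in> carrier R" "x \<in> carrier M" "y \<in> carrier N" for r x y
    unfolding tensor_rels_def Let_def by (rule UnI2) (use that in blast)
  show ?thesis
    unfolding bilinear_map_def pure_tensor_def
    by (intro conjI ballI)
      (simp_all add: gen_carrier sum mult eq[OF rels] eq[OF rels'] eq[OF rels_smult] eq[OF rels_smult']
        tensor_coset_carrier)
qed

text \<open>
  Pure tensors generate, being the images of the basis of the free module. So
  linear maps out of a tensor product may be compared on pure tensors.
\<close>

lemma tensor_induct [consumes 1, case_names zero pure add smult]:
  assumes "t \<in> carrier (tensor R M N)"
    and zero: "P \<zero>\<^bsub>tensor R M N\<^esub>"
    and pure: "\<And>x y. x \<in> carrier M \<Longrightarrow> y \<in> carrier N \<Longrightarrow> P (pure_tensor R M N x y)"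
    and add: "\<And>s t. s \<in> carrier (tensor R M N) \<Longrightarrow> t \<in> carrier (tensor R M N) \<Longrightarrow>
        P s \<Longrightarrow> P t \<Longrightarrow> P (s \<oplus>\<^bsub>tensor R M N\<^esub> t)"
    and smult: "\<And>r t. r \<in> carrier R \<Longrightarrow> t \<in> carrier (tensor R M N) \<Longrightarrow> P t \<Longrightarrow>
        P (r \<odot>\<^bsub>tensor R M N\<^esub> t)"
  shows "P t"
proof -
  interpret T: module R "tensor R M N" by (rule tensor_module)
  let ?K = "\<lambda>u. tensor_ker R M N +>\<^bsub>F\<^esub> u"
  from assms(1) obtain u where "u \<in> carrier F" and t: "t = ?K u" by (auto simp: tensor_carrier)
  have K: "?K u \<in> carrier (tensor R M N)" if "u \<in> carrier F" for u
    using that tensor_carrier by blast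
  note proj = quot_mod_proj_hom[OF free_mod_prod_module tensor_ker_submodule, folded tensor_def]
  from M.is_cring \<open>u \<in> carrier F\<close> have "P (?K u)"
  proof (induction rule: free_mod_induct)
    case zero
    have "?K \<zero>\<^bsub>F\<^esub> = \<zero>\<^bsub>tensor R M N\<^esub>"
      using mod_hom_zero[OF free_mod_prod_module tensor_module proj] F.zero_closed by (simp only: restrict_apply')
    then show ?case using \<open>P \<zero>\<^bsub>tensor R M N\<^esub>\<close> by simp
  next
    case (gen s)
    then show ?case using pure by (auto simp: pure_tensor_def)
  next
    case (add u w)
    then show ?case using assms(4)[OF K K] tensor_add by metis
  next
    case (smult r u)
    then show ?case using assms(5)[OF _ K] tensor_smult by metis
  qed
  with t show ?thesis by simp
qed

lemma tensor_hom_eqI: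
  assumes L: "module R L" and g: "g \<in> mod_hom R (tensor R M N) L" and h: "h \<in> mod_hom R (tensor R M N) L"
    and "\<And>x y. x \<in> carrier M \<Longrightarrow> y \<in> carrier N \<Longrightarrow> g (pure_tensor R M N x y) = h (pure_tensor R M N x y)"
  shows "g = h"
proof (rule mod_hom_eqI[OF g h])
  fix t assume "t \<in> carrier (tensor R M N)"
  then show "g t = h t"
    by (induction rule: tensor_induct)
      (simp_all add: assms(4) mod_hom_zero[OF tensor_module L g] mod_hom_zero[OF tensor_module L h]
        mod_hom_add[OF g] mod_hom_add[OF h] mod_hom_smult[OF g] mod_hom_smult[OF h])
qed

text \<open>
  Bilinearity says exactly that the kernel of \<open>h\<close> contains the defining relations, and a kernel is a
  submodule.
\<close>

lemma tensor_ker_killed: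
  assumes L: "module R L" and h: "h \<in> mod_hom R F L"
    and b: "bilinear_map R M N L (\<lambda>x y. h (free_gen R (x, y)))"
    and u: "u \<in> tensor_ker R M N"
  shows "h u = \<zero>\<^bsub>L\<^esub>"
proof -
  interpret L: module R L by fact
  have eq: "h (v \<ominus>\<^bsub>F\<^esub> w) = \<zero>\<^bsub>L\<^esub>" if "h v = h w" "v \<in> carrier F" "w \<in> carrier F" for v w
  proof -
    have "h v = h ((v \<ominus>\<^bsub>F\<^esub> w) \<oplus>\<^bsub>F\<^esub> w)"
      using that by (simp add: F.minus_eq F.a_assoc F.l_neg)
    also have "\<dots> = h (v \<ominus>\<^bsub>F\<^esub> w) \<oplus>\<^bsub>L\<^esub> h w"
      using that by (intro mod_hom_add[OF h] F.minus_closed)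
    finally have "\<zero>\<^bsub>L\<^esub> \<oplus>\<^bsub>L\<^esub> h w = h (v \<ominus>\<^bsub>F\<^esub> w) \<oplus>\<^bsub>L\<^esub> h w"
      using that(1) mod_hom_closed[OF h that(3)] by simp
    then show ?thesis
      using mod_hom_closed[OF h] F.minus_closed that(2,3) by (subst (asm) L.add.right_cancel) simp_all
  qed
  have "tensor_rels R M N \<subseteq> {u \<in> carrier F. h u = \<zero>\<^bsub>L\<^esub>}"
  proof
    fix u assume "u \<in> tensor_rels R M N"
    then have "h u = \<zero>\<^bsub>L\<^esub>"
      unfolding tensor_rels_def Let_def using b
      by (auto intro!: eq simp: gen_carrier mod_hom_add[OF h] mod_hom_smult[OF h] bilinear_map_def)
    then show "u \<in> {u \<in> carrier F. h u = \<zero>\<^bsub>L\<^esub>}"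
      using \<open>u \<in> tensor_rels R M N\<close> tensor_rels_carrier by blast
  qed
  with mod_hom_kernel_submodule[OF free_mod_prod_module L h]
  have "tensor_ker R M N \<subseteq> {u \<in> carrier F. h u = \<zero>\<^bsub>L\<^esub>}"
    unfolding tensor_ker_def by (rule submodule_span_least)
  with u show ?thesis by blast
qed

lemma tensor_coset_const:
  assumes "module R L" and "h \<in> mod_hom R F L"
    and "bilinear_map R M N L (\<lambda>x y. h (free_gen R (x, y)))"
    and "u \<in> carrier F" and "w \<in> tensor_ker R M N +>\<^bsub>F\<^esub> u"
  shows "h w = h u"
  using mod_hom_coset_const[OF free_mod_prod_module tensor_ker_submodule assms(1,2) tensor_ker_killed[OF assms(1-3)] assms(4,5)] .

end

text \<open>
  The linear map induced by a bilinear map \<open>b\<close>. The choice of a representative is harmless by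
  \<open>tensor_coset_const\<close>.
\<close>

definition tensor_lift ::
    "('a, 'r) ring_scheme \<Rightarrow> ('a, 'm) module \<Rightarrow> ('a, 'n) module \<Rightarrow> ('a, 'l) module
      \<Rightarrow> ('m \<Rightarrow> 'n \<Rightarrow> 'l) \<Rightarrow> ('m \<times> 'n \<Rightarrow> 'a) set \<Rightarrow> 'l" where
  "tensor_lift R M N L b =
    (\<lambda>C\<in>carrier (tensor R M N). lin_ext R L (case_prod b) (SOME u. u \<in> C))"

lemma
  assumes M: "module R M" and N: "module R N" and L: "module R L" and b: "bilinear_map R M N L b"
  shows tensor_lift_mod_hom: "tensor_lift R M N L b \<in> mod_hom R (tensor R M N) L"
    and tensor_lift_pure: "x \<in> carrier M \<Longrightarrow> y \<in> carrier N \<Longrightarrow>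
      tensor_lift R M N L b (pure_tensor R M N x y) = b x y"
proof -
  let ?S = "carrier M \<times> carrier N"
  let ?F = "free_mod R ?S" and ?K = "tensor_ker R M N"
  interpret M: module R M by fact
  have bS: "case_prod b \<in> ?S \<rightarrow> carrier L" using b by (auto simp: bilinear_map_def)
  define h where "h = (\<lambda>u\<in>carrier ?F. lin_ext R L (case_prod b) u)"
  have h: "h \<in> mod_hom R ?F L" unfolding h_def by (rule lin_ext_mod_hom[OF L bS])
  have hgen: "h (free_gen R (x, y)) = b x y" if "x \<in> carrier M" "y \<in> carrier N" for x y
    using that lin_ext_gen[OF L bS, of "(x, y)"] gen_carrier[OF M N that] by (simp add: h_def)
  have bil: "bilinear_map R M N L (\<lambda>x y. h (free_gen R (x, y)))"
    by (rule bilinear_map_cong[OF M N b hgen])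
  have lift: "tensor_lift R M N L b (?K +>\<^bsub>?F\<^esub> u) = h u" if u: "u \<in> carrier ?F" for u
  proof -
    note sub = tensor_ker_submodule[OF M N] free_mod_prod_module[OF M N]
    interpret K: abelian_subgroup ?K ?F by (rule submodule_abelian_subgroup[OF sub(2,1)])
    let ?w = "SOME w. w \<in> ?K +>\<^bsub>?F\<^esub> u"
    have w: "?w \<in> ?K +>\<^bsub>?F\<^esub> u"
      by (rule someI[of "\<lambda>w. w \<in> ?K +>\<^bsub>?F\<^esub> u"]) (rule K.a_rcos_self[OF u])
    then have "?w \<in> carrier ?F" by (rule coset_mem_carrier[OF sub(2,1) u])
    then have "lin_ext R L (case_prod b) ?w = h ?w" by (simp only: h_def restrict_apply')
    also have "\<dots> = h u" by (rule tensor_coset_const[OF M N L h bil u w])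
    finally show ?thesis using u tensor_carrier[OF M N] unfolding tensor_lift_def by (subst restrict_apply') blast+
  qed
  show "tensor_lift R M N L b \<in> mod_hom R (tensor R M N) L"
    using h lift unfolding tensor_def
    by (intro quot_mod_homI[OF free_mod_prod_module[OF M N] tensor_ker_submodule[OF M N]])
      (auto simp: tensor_lift_def tensor_def)
  show "tensor_lift R M N L b (pure_tensor R M N x y) = b x y" if "x \<in> carrier M" "y \<in> carrier N"
    unfolding pure_tensor_def using that by (simp add: lift gen_carrier[OF M N] hgen)
qed

text \<open>
  Composing \<open>free_map (map_prod f g)\<close> with the projection onto \<open>M' \<otimes> N'\<close> gives a linear map on the
  free module which is bilinear on generators. Hence it is constant on cosets, and the union in
  \<open>tensor_map\<close> is its common value.
\<close>

lemma
  assumes M: "module R M" and N: "module R N" and M': "module R M'" and N': "module R N'"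
    and f: "f \<in> mod_hom R M M'" and g: "g \<in> mod_hom R N N'"
  shows tensor_map_mod_hom:
      "tensor_map R M N M' N' f g \<in> mod_hom R (tensor R M N) (tensor R M' N')"
    and tensor_map_pure: "x \<in> carrier M \<Longrightarrow> y \<in> carrier N \<Longrightarrow>
      tensor_map R M N M' N' f g (pure_tensor R M N x y) = pure_tensor R M' N' (f x) (g y)"
proof -
  let ?S = "carrier M \<times> carrier N" and ?S' = "carrier M' \<times> carrier N'"
  let ?F = "free_mod R ?S" and ?K = "tensor_ker R M N"
  let ?F' = "free_mod R ?S'" and ?K' = "tensor_ker R M' N'"
  interpret M: module R M by fact
  have fg: "map_prod f g \<in> ?S \<rightarrow> ?S'" using mod_hom_closed[OF f] mod_hom_closed[OF g] by auto
  note map = free_map_mod_hom[OF M.is_cring fg]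
  note proj = quot_mod_proj_hom[OF free_mod_prod_module[OF M' N'] tensor_ker_submodule[OF M' N'], folded tensor_def]
  define h where "h = compose (carrier ?F) (\<lambda>u\<in>carrier ?F'. ?K' +>\<^bsub>?F'\<^esub> u) (\<lambda>u\<in>carrier ?F. free_map R (map_prod f g) u)"
  have h: "h \<in> mod_hom R ?F (tensor R M' N')"
    unfolding h_def by (rule mod_hom_compose[OF free_mod_prod_module[OF M N] map proj])
  have h_eq: "h u = ?K' +>\<^bsub>?F'\<^esub> free_map R (map_prod f g) u" if "u \<in> carrier ?F" for u
    using that mod_hom_closed[OF map that] by (simp add: h_def compose_def)
  have hgen: "h (free_gen R (x, y)) = pure_tensor R M' N' (f x) (g y)"
    if "x \<in> carrier M" "y \<in> carrier N" for x y
    using that by (simp add: h_eq gen_carrier[OF M N] free_map_gen[OF M.is_cring fg] pure_tensor_def)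
  have bil: "bilinear_map R M N (tensor R M' N') (\<lambda>x y. h (free_gen R (x, y)))"
    by (rule bilinear_map_cong[OF M N bilinear_map_compose[OF pure_tensor_bilinear[OF M' N'] f g] hgen])
  have map_eq: "tensor_map R M N M' N' f g (?K +>\<^bsub>?F\<^esub> u) = h u" if u: "u \<in> carrier ?F" for u
  proof -
    note sub = tensor_ker_submodule[OF M N] free_mod_prod_module[OF M N]
    have "(\<Union>w\<in>?K +>\<^bsub>?F\<^esub> u. ?K' +>\<^bsub>?F'\<^esub> free_map R (map_prod f g) w) = ?K' +>\<^bsub>?F'\<^esub> free_map R (map_prod f g) u"
    proof (rule coset_const_UNION[OF sub(2,1) u])
      fix w assume w: "w \<in> ?K +>\<^bsub>?F\<^esub> u"
      then have "w \<in> carrier ?F" by (rule coset_mem_carrier[OF sub(2,1) u])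
      with u tensor_coset_const[OF M N tensor_module[OF M' N'] h bil u w]
      show "?K' +>\<^bsub>?F'\<^esub> free_map R (map_prod f g) w = ?K' +>\<^bsub>?F'\<^esub> free_map R (map_prod f g) u"
        by (simp only: h_eq)
    qed
    then show ?thesis using u tensor_carrier[OF M N] unfolding tensor_map_def h_eq[OF u] by (subst restrict_apply') blast+
  qed
  show "tensor_map R M N M' N' f g \<in> mod_hom R (tensor R M N) (tensor R M' N')"
    using h map_eq unfolding tensor_def[of R M N]
    by (intro quot_mod_homI[OF free_mod_prod_module[OF M N] tensor_ker_submodule[OF M N]])
      (auto simp: tensor_map_def tensor_def)
  show "tensor_map R M N M' N' f g (pure_tensor R M N x y) = pure_tensor R M' N' (f x) (g y)"
    if "x \<in> carrier M" "y \<in> carrier N"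
    unfolding pure_tensor_def[of R M N] using that by (simp add: map_eq gen_carrier[OF M N] hgen)
qed


section \<open>Representations of a quiver\<close>

locale quiver_over_ring =
  fixes R :: "('a, 'r) ring_scheme" and Q :: "('v, 'e) pre_digraph"
  assumes ring: "cring R" and quiver: "wf_digraph Q"
begin

lemma tail_vert [simp]: "\<alpha> \<in> arcs Q \<Longrightarrow> tail Q \<alpha> \<in> verts Q"
  and head_vert [simp]: "\<alpha> \<in> arcs Q \<Longrightarrow> head Q \<alpha> \<in> verts Q"
  using quiver by (auto simp: wf_digraph_def)

lemma
  assumes "is_rep R Q X"
  shows rep_module: "i \<in> verts Q \<Longrightarrow> module R (vmod X i)"
    and rep_amap: "\<alpha> \<in> arcs Q \<Longrightarrow> amap X \<alpha> \<in> mod_hom R (vmod X (tail Q \<alpha>)) (vmod X (head Q \<alpha>))"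
  using assms by (auto simp: is_rep_def)

lemma rep_amap_closed:
  assumes "is_rep R Q X" and "\<alpha> \<in> arcs Q" and "x \<in> carrier (vmod X (tail Q \<alpha>))"
  shows "amap X \<alpha> x \<in> carrier (vmod X (head Q \<alpha>))"
  using mod_hom_closed[OF rep_amap[OF assms(1,2)] assms(3)] .

lemma rep_homI:
  assumes "f \<in> extensional (verts Q)"
    and "\<And>i. i \<in> verts Q \<Longrightarrow> f i \<in> mod_hom R (vmod X i) (vmod Y i)"
    and "\<And>\<alpha> x. \<alpha> \<in> arcs Q \<Longrightarrow> x \<in> carrier (vmod X (tail Q \<alpha>)) \<Longrightarrow>
      f (head Q \<alpha>) (amap X \<alpha> x) = amap Y \<alpha> (f (tail Q \<alpha>) x)"
  shows "f \<in> rep_hom R Q X Y"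
  using assms by (auto simp: rep_hom_def PiE_iff)

lemma
  assumes "f \<in> rep_hom R Q X Y"
  shows rep_hom_extensional: "f \<in> extensional (verts Q)"
    and rep_hom_vertex: "i \<in> verts Q \<Longrightarrow> f i \<in> mod_hom R (vmod X i) (vmod Y i)"
    and rep_hom_natural: "\<alpha> \<in> arcs Q \<Longrightarrow> x \<in> carrier (vmod X (tail Q \<alpha>)) \<Longrightarrow>
      f (head Q \<alpha>) (amap X \<alpha> x) = amap Y \<alpha> (f (tail Q \<alpha>) x)"
  using assms by (auto simp: rep_hom_def PiE_iff)

lemma rep_hom_closed:
  assumes "f \<in> rep_hom R Q X Y" and "i \<in> verts Q" and "x \<in> carrier (vmod X i)"
  shows "f i x \<in> carrier (vmod Y i)"
  using mod_hom_closed[OF rep_hom_vertex[OF assms(1,2)] assms(3)] .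

lemma rep_hom_eqI:
  assumes "f \<in> rep_hom R Q X Y" and "g \<in> rep_hom R Q X Y'"
    and "\<And>i x. i \<in> verts Q \<Longrightarrow> x \<in> carrier (vmod X i) \<Longrightarrow> f i x = g i x"
  shows "f = g"
proof (rule extensionalityI)
  show "f \<in> extensional (verts Q)" "g \<in> extensional (verts Q)"
    using assms by (auto intro: rep_hom_extensional)
  show "f i = g i" if "i \<in> verts Q" for i
    using assms(3)[OF that] by (rule mod_hom_eqI[OF rep_hom_vertex[OF assms(1) that] rep_hom_vertex[OF assms(2) that]])
qed

lemma rep_comp_apply [simp]:
  "i \<in> verts Q \<Longrightarrow> x \<in> carrier (vmod X i) \<Longrightarrow> rep_comp Q X g f i x = g i (f i x)"
  by (simp add: rep_comp_def compose_def)

lemma rep_comp_hom: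
  assumes X: "is_rep R Q X" and f: "f \<in> rep_hom R Q X Y" and g: "g \<in> rep_hom R Q Y Z"
  shows "rep_comp Q X g f \<in> rep_hom R Q X Z"
proof (rule rep_homI)
  show "rep_comp Q X g f \<in> extensional (verts Q)" by (simp add: rep_comp_def)
  show "rep_comp Q X g f i \<in> mod_hom R (vmod X i) (vmod Z i)" if "i \<in> verts Q" for i
    using that mod_hom_compose[OF rep_module[OF X that] rep_hom_vertex[OF f that] rep_hom_vertex[OF g that]]
    by (simp add: rep_comp_def)
qed (simp add: rep_amap_closed[OF X] rep_hom_closed[OF f] rep_hom_natural[OF f] rep_hom_natural[OF g])

lemma rep_comp_assoc:
  assumes "f \<in> rep_hom R Q X Y"
  shows "rep_comp Q X h (rep_comp Q X g f) = rep_comp Q X (rep_comp Q Y h g) f"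
  using assms by (auto simp: rep_comp_def compose_def fun_eq_iff restrict_def rep_hom_closed)

lemma rep_comp_id_left:
  assumes X: "is_rep R Q X" and f: "f \<in> rep_hom R Q X Y"
  shows "rep_comp Q X (rep_id Q Y) f = f"
proof (rule extensionalityI[OF _ rep_hom_extensional[OF f]])
  show "rep_comp Q X (rep_id Q Y) f \<in> extensional (verts Q)" by (simp add: rep_comp_def)
  fix i assume i: "i \<in> verts Q"
  have "f i \<in> extensional (carrier (vmod X i))"
    using mod_hom_PiE[OF rep_hom_vertex[OF f i]] by (simp add: PiE_iff)
  then show "rep_comp Q X (rep_id Q Y) f i = f i"
    using i by (intro extensionalityI[of _ "carrier (vmod X i)"])
      (auto simp: rep_comp_def rep_id_def compose_def rep_hom_closed[OF f])
qed

lemma rep_id_vertex: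
  assumes "is_rep R Q X" and "i \<in> verts Q"
  shows "rep_id Q X i \<in> mod_hom R (vmod X i) (vmod X i)"
  using mod_hom_id[OF rep_module[OF assms]] assms(2) by (simp add: rep_id_def)


section \<open>Modules of homomorphisms\<close>

lemma hom_mod_simps:
  "carrier (hom_mod R Q X Y) = rep_hom R Q X Y"
  "\<zero>\<^bsub>hom_mod R Q X Y\<^esub> = (\<lambda>i\<in>verts Q. \<lambda>x\<in>carrier (vmod X i). \<zero>\<^bsub>vmod Y i\<^esub>)"
  "f \<oplus>\<^bsub>hom_mod R Q X Y\<^esub> g = (\<lambda>i\<in>verts Q. \<lambda>x\<in>carrier (vmod X i). f i x \<oplus>\<^bsub>vmod Y i\<^esub> g i x)"
  "r \<odot>\<^bsub>hom_mod R Q X Y\<^esub> f = (\<lambda>i\<in>verts Q. \<lambda>x\<in>carrier (vmod X i). r \<odot>\<^bsub>vmod Y i\<^esub> f i x)"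
  by (simp_all add: hom_mod_def)

text \<open>
  The module operations on homomorphisms are all given by pointwise formulas of this form.
\<close>

lemma pointwise_rep_homI:
  assumes X: "is_rep R Q X"
    and "\<And>i x. i \<in> verts Q \<Longrightarrow> x \<in> carrier (vmod X i) \<Longrightarrow> f i x \<in> carrier (vmod Y i)"
    and "\<And>i x y. i \<in> verts Q \<Longrightarrow> x \<in> carrier (vmod X i) \<Longrightarrow> y \<in> carrier (vmod X i) \<Longrightarrow>
      f i (x \<oplus>\<^bsub>vmod X i\<^esub> y) = f i x \<oplus>\<^bsub>vmod Y i\<^esub> f i y"
    and "\<And>i r x. i \<in> verts Q \<Longrightarrow> r \<in> carrier R \<Longrightarrow> x \<in> carrier (vmod X i) \<Longrightarrow>
      f i (r \<odot>\<^bsub>vmod X i\<^esub> x) = r \<odot>\<^bsub>vmod Y i\<^esub> f i x"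
    and "\<And>\<alpha> x. \<alpha> \<in> arcs Q \<Longrightarrow> x \<in> carrier (vmod X (tail Q \<alpha>)) \<Longrightarrow>
      f (head Q \<alpha>) (amap X \<alpha> x) = amap Y \<alpha> (f (tail Q \<alpha>) x)"
  shows "(\<lambda>i\<in>verts Q. \<lambda>x\<in>carrier (vmod X i). f i x) \<in> rep_hom R Q X Y"
proof (rule rep_homI)
  fix i assume i: "i \<in> verts Q"
  interpret Xi: module R "vmod X i" by (rule rep_module[OF X i])
  show "(\<lambda>i\<in>verts Q. \<lambda>x\<in>carrier (vmod X i). f i x) i \<in> mod_hom R (vmod X i) (vmod Y i)"
    using i assms(2-4) by (intro mod_homI) (auto simp: PiE_iff)
qed (simp_all add: rep_amap_closed[OF X] assms(5))

lemma hom_mod_module: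
  assumes X: "is_rep R Q X" and Y: "is_rep R Q Y"
  shows "module R (hom_mod R Q X Y)"
proof -
  have Yi: "module R (vmod Y i)" if "i \<in> verts Q" for i using rep_module[OF Y that] .
  note group = abelian_group.axioms(1)[OF module.axioms(2)[OF Yi]]
  note closed = abelian_monoid.a_closed[OF group] module.smult_closed[OF Yi]
    abelian_monoid.zero_closed[OF group] abelian_group.a_inv_closed[OF module.axioms(2)[OF Yi]]
  note amapY = mod_hom_add[OF rep_amap[OF Y]] mod_hom_smult[OF rep_amap[OF Y]]
    mod_hom_zero[OF Yi Yi rep_amap[OF Y]]
  note homs = rep_hom_closed mod_hom_add[OF rep_hom_vertex] mod_hom_smult[OF rep_hom_vertex] rep_hom_natural
  have smult_comm: "r \<odot>\<^bsub>vmod Y i\<^esub> (s \<odot>\<^bsub>vmod Y i\<^esub> y) = s \<odot>\<^bsub>vmod Y i\<^esub> (r \<odot>\<^bsub>vmod Y i\<^esub> y)"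
    if "i \<in> verts Q" "r \<in> carrier R" "s \<in> carrier R" "y \<in> carrier (vmod Y i)" for i r s y
    using that module.smult_assoc1[OF Yi] cring.cring_simprules(14)[OF ring] by metis
  have zero: "\<zero>\<^bsub>hom_mod R Q X Y\<^esub> \<in> rep_hom R Q X Y"
    unfolding hom_mod_simps
    by (rule pointwise_rep_homI[OF X])
      (simp_all add: closed amapY abelian_monoid.l_zero[OF group] module.smult_r_null[OF Yi])
  have add: "f \<oplus>\<^bsub>hom_mod R Q X Y\<^esub> g \<in> rep_hom R Q X Y"
    if "f \<in> rep_hom R Q X Y" "g \<in> rep_hom R Q X Y" for f g
    unfolding hom_mod_simps
  proof (rule pointwise_rep_homI[OF X])
    fix i x y assume i: "i \<in> verts Q" and "x \<in> carrier (vmod X i)" "y \<in> carrier (vmod X i)"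
    interpret Yi: module R "vmod Y i" by (rule Yi[OF i])
    show "f i (x \<oplus>\<^bsub>vmod X i\<^esub> y) \<oplus>\<^bsub>vmod Y i\<^esub> g i (x \<oplus>\<^bsub>vmod X i\<^esub> y)
        = (f i x \<oplus>\<^bsub>vmod Y i\<^esub> g i x) \<oplus>\<^bsub>vmod Y i\<^esub> (f i y \<oplus>\<^bsub>vmod Y i\<^esub> g i y)"
      using that i \<open>x \<in> _\<close> \<open>y \<in> _\<close> by (simp add: homs Yi.a_ac)
  qed (simp_all add: homs[OF that(1)] homs[OF that(2)] closed amapY module.smult_r_distr[OF Yi])
  have smult: "r \<odot>\<^bsub>hom_mod R Q X Y\<^esub> f \<in> rep_hom R Q X Y"
    if "r \<in> carrier R" "f \<in> rep_hom R Q X Y" for r f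
    unfolding hom_mod_simps
    by (rule pointwise_rep_homI[OF X])
      (simp_all add: that homs[OF that(2)] closed amapY module.smult_r_distr[OF Yi] smult_comm)
  have neg: "(\<lambda>i\<in>verts Q. \<lambda>x\<in>carrier (vmod X i). \<ominus>\<^bsub>vmod Y i\<^esub> f i x) \<in> rep_hom R Q X Y"
    if f: "f \<in> rep_hom R Q X Y" for f
  proof -
    interpret cring R by (rule ring)
    have minus: "\<ominus>\<^bsub>vmod Y i\<^esub> f i x = (\<ominus>\<^bsub>R\<^esub> \<one>\<^bsub>R\<^esub>) \<odot>\<^bsub>vmod Y i\<^esub> f i x"
      if "i \<in> verts Q" "x \<in> carrier (vmod X i)" for i x
      using that f by (simp add: module.smult_l_minus[OF Yi] module.smult_one[OF Yi] homs)
    have "(\<lambda>i\<in>verts Q. \<lambda>x\<in>carrier (vmod X i). \<ominus>\<^bsub>vmod Y i\<^esub> f i x) = (\<ominus>\<^bsub>R\<^esub> \<one>\<^bsub>R\<^esub>) \<odot>\<^bsub>hom_mod R Q X Y\<^esub> f"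
      unfolding hom_mod_simps by (intro restrict_ext minus)
    then show ?thesis using smult[OF _ f] by simp
  qed
  have eqI: "f = g" if "f \<in> rep_hom R Q X Y" "g \<in> rep_hom R Q X Y"
    "\<And>i x. i \<in> verts Q \<Longrightarrow> x \<in> carrier (vmod X i) \<Longrightarrow> f i x = g i x" for f g
    using that by (rule rep_hom_eqI)
  have add_apply: "(f \<oplus>\<^bsub>hom_mod R Q X Y\<^esub> g) i x = f i x \<oplus>\<^bsub>vmod Y i\<^esub> g i x"
    and smult_apply: "(r \<odot>\<^bsub>hom_mod R Q X Y\<^esub> f) i x = r \<odot>\<^bsub>vmod Y i\<^esub> f i x"
    and zero_apply: "\<zero>\<^bsub>hom_mod R Q X Y\<^esub> i x = \<zero>\<^bsub>vmod Y i\<^esub>"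
    if "i \<in> verts Q" "x \<in> carrier (vmod X i)" for f g r i x
    using that by (simp_all add: hom_mod_simps)
  note apply_simps = add_apply smult_apply zero_apply rep_hom_closed
  show ?thesis
  proof (rule moduleI[OF ring])
    show "abelian_group (hom_mod R Q X Y)"
    proof (rule abelian_groupI, unfold hom_mod_simps(1))
      fix f assume f: "f \<in> rep_hom R Q X Y"
      have "(\<lambda>i\<in>verts Q. \<lambda>x\<in>carrier (vmod X i). \<ominus>\<^bsub>vmod Y i\<^esub> f i x) \<oplus>\<^bsub>hom_mod R Q X Y\<^esub> f = \<zero>\<^bsub>hom_mod R Q X Y\<^esub>"
        using f abelian_group.l_neg[OF module.axioms(2)[OF Yi]]
        by (intro eqI add neg zero) (simp_all add: apply_simps)
      then show "\<exists>g\<in>rep_hom R Q X Y. g \<oplus>\<^bsub>hom_mod R Q X Y\<^esub> f = \<zero>\<^bsub>hom_mod R Q X Y\<^esub>"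
        using neg[OF f] by blast
    next
      show "f \<oplus>\<^bsub>hom_mod R Q X Y\<^esub> g \<oplus>\<^bsub>hom_mod R Q X Y\<^esub> h = f \<oplus>\<^bsub>hom_mod R Q X Y\<^esub> (g \<oplus>\<^bsub>hom_mod R Q X Y\<^esub> h)"
        if "f \<in> rep_hom R Q X Y" "g \<in> rep_hom R Q X Y" "h \<in> rep_hom R Q X Y" for f g h
        using that by (intro eqI add) (simp_all add: apply_simps abelian_monoid.a_assoc[OF group])
      show "f \<oplus>\<^bsub>hom_mod R Q X Y\<^esub> g = g \<oplus>\<^bsub>hom_mod R Q X Y\<^esub> f"
        if "f \<in> rep_hom R Q X Y" "g \<in> rep_hom R Q X Y" for f g
        using that by (intro eqI add) (simp_all add: apply_simps abelian_monoid.a_comm[OF group])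
      show "\<zero>\<^bsub>hom_mod R Q X Y\<^esub> \<oplus>\<^bsub>hom_mod R Q X Y\<^esub> f = f" if "f \<in> rep_hom R Q X Y" for f
        using that by (intro eqI add zero) (simp_all add: apply_simps abelian_monoid.l_zero[OF group])
    qed (rule add zero; assumption)+
  next
    interpret cring R by (rule ring)
    note [simp] = hom_mod_simps(1) apply_simps
    show "r \<odot>\<^bsub>hom_mod R Q X Y\<^esub> f \<in> carrier (hom_mod R Q X Y)"
      if "r \<in> carrier R" "f \<in> carrier (hom_mod R Q X Y)" for r f
      using that by (simp add: smult)
    show "(r \<oplus>\<^bsub>R\<^esub> s) \<odot>\<^bsub>hom_mod R Q X Y\<^esub> f
        = r \<odot>\<^bsub>hom_mod R Q X Y\<^esub> f \<oplus>\<^bsub>hom_mod R Q X Y\<^esub> s \<odot>\<^bsub>hom_mod R Q X Y\<^esub> f"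
      if "r \<in> carrier R" "s \<in> carrier R" "f \<in> carrier (hom_mod R Q X Y)" for r s f
      using that by (intro eqI add smult) (simp_all add: module.smult_l_distr[OF Yi])
    show "r \<odot>\<^bsub>hom_mod R Q X Y\<^esub> (f \<oplus>\<^bsub>hom_mod R Q X Y\<^esub> g)
        = r \<odot>\<^bsub>hom_mod R Q X Y\<^esub> f \<oplus>\<^bsub>hom_mod R Q X Y\<^esub> r \<odot>\<^bsub>hom_mod R Q X Y\<^esub> g"
      if "r \<in> carrier R" "f \<in> carrier (hom_mod R Q X Y)" "g \<in> carrier (hom_mod R Q X Y)" for r f g
      using that by (intro eqI add smult) (simp_all add: module.smult_r_distr[OF Yi])
    show "(r \<otimes>\<^bsub>R\<^esub> s) \<odot>\<^bsub>hom_mod R Q X Y\<^esub> f = r \<odot>\<^bsub>hom_mod R Q X Y\<^esub> (s \<odot>\<^bsub>hom_mod R Q X Y\<^esub> f)"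
      if "r \<in> carrier R" "s \<in> carrier R" "f \<in> carrier (hom_mod R Q X Y)" for r s f
      using that by (intro eqI add smult) (simp_all add: module.smult_assoc1[OF Yi])
    show "\<one>\<^bsub>R\<^esub> \<odot>\<^bsub>hom_mod R Q X Y\<^esub> f = f" if "f \<in> carrier (hom_mod R Q X Y)" for f
      using that by (intro eqI add smult) (simp_all add: module.smult_one[OF Yi])
  qed
qed

lemma precomp_mod_hom:
  assumes W: "is_rep R Q W" and Y: "is_rep R Q Y" and f: "f \<in> rep_hom R Q W' W" and W': "is_rep R Q W'"
  shows "(\<lambda>\<phi>\<in>rep_hom R Q W Y. rep_comp Q W' \<phi> f) \<in> mod_hom R (hom_mod R Q W Y) (hom_mod R Q W' Y)"
proof -
  interpret H: module R "hom_mod R Q W Y" by (rule hom_mod_module[OF W Y])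
  interpret H': module R "hom_mod R Q W' Y" by (rule hom_mod_module[OF W' Y])
  note comp = rep_comp_hom[OF W' f, of _ Y]
  have closed: "\<phi> \<oplus>\<^bsub>hom_mod R Q W Y\<^esub> \<psi> \<in> rep_hom R Q W Y" "r \<odot>\<^bsub>hom_mod R Q W Y\<^esub> \<phi> \<in> rep_hom R Q W Y"
    if "\<phi> \<in> rep_hom R Q W Y" "\<psi> \<in> rep_hom R Q W Y" "r \<in> carrier R" for \<phi> \<psi> r
    using that H.add.m_closed H.smult_closed by (simp_all add: hom_mod_simps(1))
  have closed': "\<phi> \<oplus>\<^bsub>hom_mod R Q W' Y\<^esub> \<psi> \<in> rep_hom R Q W' Y" "r \<odot>\<^bsub>hom_mod R Q W' Y\<^esub> \<phi> \<in> rep_hom R Q W' Y"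
    if "\<phi> \<in> rep_hom R Q W' Y" "\<psi> \<in> rep_hom R Q W' Y" "r \<in> carrier R" for \<phi> \<psi> r
    using that H'.add.m_closed H'.smult_closed by (simp_all add: hom_mod_simps(1))
  show ?thesis
  proof (rule mod_homI)
    show "(\<lambda>\<phi>\<in>rep_hom R Q W Y. rep_comp Q W' \<phi> f) \<in> carrier (hom_mod R Q W Y) \<rightarrow>\<^sub>E carrier (hom_mod R Q W' Y)"
      by (auto simp: PiE_iff hom_mod_simps(1) comp)
  next
    fix \<phi> \<psi> assume "\<phi> \<in> carrier (hom_mod R Q W Y)" "\<psi> \<in> carrier (hom_mod R Q W Y)"
    then have h: "\<phi> \<in> rep_hom R Q W Y" "\<psi> \<in> rep_hom R Q W Y" by (simp_all add: hom_mod_simps(1))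
    note sum = closed(1)[OF h H.R.zero_closed]
    have "rep_comp Q W' (\<phi> \<oplus>\<^bsub>hom_mod R Q W Y\<^esub> \<psi>) f = rep_comp Q W' \<phi> f \<oplus>\<^bsub>hom_mod R Q W' Y\<^esub> rep_comp Q W' \<psi> f"
      by (rule rep_hom_eqI[OF comp[OF sum] closed'(1)[OF comp[OF h(1)] comp[OF h(2)] H.R.zero_closed]])
        (simp add: rep_hom_closed[OF f], simp add: hom_mod_simps rep_hom_closed[OF f])
    with h sum show "(\<lambda>\<phi>\<in>rep_hom R Q W Y. rep_comp Q W' \<phi> f) (\<phi> \<oplus>\<^bsub>hom_mod R Q W Y\<^esub> \<psi>)
        = (\<lambda>\<phi>\<in>rep_hom R Q W Y. rep_comp Q W' \<phi> f) \<phi> \<oplus>\<^bsub>hom_mod R Q W' Y\<^esub> (\<lambda>\<phi>\<in>rep_hom R Q W Y. rep_comp Q W' \<phi> f) \<psi>"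
      by simp
  next
    fix r \<phi> assume r: "r \<in> carrier R" and "\<phi> \<in> carrier (hom_mod R Q W Y)"
    then have h: "\<phi> \<in> rep_hom R Q W Y" by (simp add: hom_mod_simps(1))
    note mult = closed(2)[OF h h r]
    have "rep_comp Q W' (r \<odot>\<^bsub>hom_mod R Q W Y\<^esub> \<phi>) f = r \<odot>\<^bsub>hom_mod R Q W' Y\<^esub> rep_comp Q W' \<phi> f"
      by (rule rep_hom_eqI[OF comp[OF mult] closed'(2)[OF comp[OF h] comp[OF h] r]])
        (simp add: rep_hom_closed[OF f], simp add: hom_mod_simps rep_hom_closed[OF f])
    with h mult show "(\<lambda>\<phi>\<in>rep_hom R Q W Y. rep_comp Q W' \<phi> f) (r \<odot>\<^bsub>hom_mod R Q W Y\<^esub> \<phi>)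
        = r \<odot>\<^bsub>hom_mod R Q W' Y\<^esub> (\<lambda>\<phi>\<in>rep_hom R Q W Y. rep_comp Q W' \<phi> f) \<phi>"
      by simp
  qed
qed

lemma postcomp_mod_hom:
  assumes W: "is_rep R Q W" and Y: "is_rep R Q Y" and Y': "is_rep R Q Y'" and g: "g \<in> rep_hom R Q Y Y'"
  shows "(\<lambda>\<phi>\<in>rep_hom R Q W Y. rep_comp Q W g \<phi>) \<in> mod_hom R (hom_mod R Q W Y) (hom_mod R Q W Y')"
proof -
  interpret H: module R "hom_mod R Q W Y" by (rule hom_mod_module[OF W Y])
  interpret H': module R "hom_mod R Q W Y'" by (rule hom_mod_module[OF W Y'])
  note comp = rep_comp_hom[OF W _ g]
  show ?thesis
  proof (rule mod_homI)
    show "(\<lambda>\<phi>\<in>rep_hom R Q W Y. rep_comp Q W g \<phi>) \<in> carrier (hom_mod R Q W Y) \<rightarrow>\<^sub>E carrier (hom_mod R Q W Y')"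
      by (auto simp: PiE_iff hom_mod_simps(1) comp)
  next
    fix \<phi> \<psi> assume h: "\<phi> \<in> carrier (hom_mod R Q W Y)" "\<psi> \<in> carrier (hom_mod R Q W Y)"
    have sum: "\<phi> \<oplus>\<^bsub>hom_mod R Q W Y\<^esub> \<psi> \<in> rep_hom R Q W Y" using H.add.m_closed[OF h] by (simp add: hom_mod_simps(1))
    have sum': "rep_comp Q W g \<phi> \<oplus>\<^bsub>hom_mod R Q W Y'\<^esub> rep_comp Q W g \<psi> \<in> rep_hom R Q W Y'"
      using H'.add.m_closed h comp by (simp add: hom_mod_simps(1))
    have "rep_comp Q W g (\<phi> \<oplus>\<^bsub>hom_mod R Q W Y\<^esub> \<psi>) = rep_comp Q W g \<phi> \<oplus>\<^bsub>hom_mod R Q W Y'\<^esub> rep_comp Q W g \<psi>"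
      using h
      by (intro rep_hom_eqI[OF comp[OF sum] sum'], subst rep_comp_apply)
        (simp_all add: hom_mod_simps rep_hom_closed mod_hom_add[OF rep_hom_vertex[OF g]])
    with h sum show "(\<lambda>\<phi>\<in>rep_hom R Q W Y. rep_comp Q W g \<phi>) (\<phi> \<oplus>\<^bsub>hom_mod R Q W Y\<^esub> \<psi>)
        = (\<lambda>\<phi>\<in>rep_hom R Q W Y. rep_comp Q W g \<phi>) \<phi> \<oplus>\<^bsub>hom_mod R Q W Y'\<^esub> (\<lambda>\<phi>\<in>rep_hom R Q W Y. rep_comp Q W g \<phi>) \<psi>"
      by (simp add: hom_mod_simps(1))
  next
    fix r \<phi> assume r: "r \<in> carrier R" and h: "\<phi> \<in> carrier (hom_mod R Q W Y)"
    have mult: "r \<odot>\<^bsub>hom_mod R Q W Y\<^esub> \<phi> \<in> rep_hom R Q W Y" using H.smult_closed[OF r h] by (simp add: hom_mod_simps(1))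
    have mult': "r \<odot>\<^bsub>hom_mod R Q W Y'\<^esub> rep_comp Q W g \<phi> \<in> rep_hom R Q W Y'"
      using H'.smult_closed[OF r] h comp by (simp add: hom_mod_simps(1))
    have "rep_comp Q W g (r \<odot>\<^bsub>hom_mod R Q W Y\<^esub> \<phi>) = r \<odot>\<^bsub>hom_mod R Q W Y'\<^esub> rep_comp Q W g \<phi>"
      using h r
      by (intro rep_hom_eqI[OF comp[OF mult] mult'], subst rep_comp_apply)
        (simp_all add: hom_mod_simps rep_hom_closed mod_hom_smult[OF rep_hom_vertex[OF g]])
    with h mult show "(\<lambda>\<phi>\<in>rep_hom R Q W Y. rep_comp Q W g \<phi>) (r \<odot>\<^bsub>hom_mod R Q W Y\<^esub> \<phi>)
        = r \<odot>\<^bsub>hom_mod R Q W Y'\<^esub> (\<lambda>\<phi>\<in>rep_hom R Q W Y. rep_comp Q W g \<phi>) \<phi>"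
      by (simp add: hom_mod_simps(1))
  qed
qed


section \<open>The vertexwise tensor product\<close>

lemma box_simps:
  "vmod (box R Q X Z) i = tensor R (vmod X i) (vmod Z i)"
  "amap (box R Q X Z) \<alpha> = tensor_map R (vmod X (tail Q \<alpha>)) (vmod Z (tail Q \<alpha>))
      (vmod X (head Q \<alpha>)) (vmod Z (head Q \<alpha>)) (amap X \<alpha>) (amap Z \<alpha>)"
  by (simp_all add: box_def)

abbreviation rep_tensor ::
    "('v, 'e, 'a, 'x) qrep \<Rightarrow> ('v, 'e, 'a, 'z) qrep \<Rightarrow> 'v \<Rightarrow> 'x \<Rightarrow> 'z \<Rightarrow> ('x \<times> 'z \<Rightarrow> 'a) set" where
  "rep_tensor X Z i \<equiv> pure_tensor R (vmod X i) (vmod Z i)"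

lemma rep_tensor_bilinear:
  assumes "is_rep R Q X" and "is_rep R Q Z" and "i \<in> verts Q"
  shows "bilinear_map R (vmod X i) (vmod Z i) (vmod (box R Q X Z) i) (rep_tensor X Z i)"
  unfolding box_simps by (rule pure_tensor_bilinear[OF assms(1,2)[THEN rep_module, OF assms(3)]])

lemma rep_tensor_closed:
  assumes "is_rep R Q X" and "is_rep R Q Z" and "i \<in> verts Q"
    and "x \<in> carrier (vmod X i)" and "z \<in> carrier (vmod Z i)"
  shows "rep_tensor X Z i x z \<in> carrier (vmod (box R Q X Z) i)"
  using rep_tensor_bilinear[OF assms(1-3)] assms(4,5) by (simp add: bilinear_map_def)

lemma box_amap_pure:
  assumes "is_rep R Q X" and "is_rep R Q Z" and "\<alpha> \<in> arcs Q"
    and "x \<in> carrier (vmod X (tail Q \<alpha>))" and "z \<in> carrier (vmod Z (tail Q \<alpha>))"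
  shows "amap (box R Q X Z) \<alpha> (rep_tensor X Z (tail Q \<alpha>) x z)
    = rep_tensor X Z (head Q \<alpha>) (amap X \<alpha> x) (amap Z \<alpha> z)"
  unfolding box_simps using assms
  by (intro tensor_map_pure rep_module rep_amap tail_vert head_vert)

lemma box_is_rep:
  assumes "is_rep R Q X" and "is_rep R Q Z"
  shows "is_rep R Q (box R Q X Z)"
  using assms unfolding is_rep_def[of R Q "box R Q X Z"] box_simps
  by (auto intro!: tensor_map_mod_hom tensor_module intro: rep_module rep_amap)

text \<open>
  Both ways around the square of an arrow are linear, so naturality may be checked on pure tensors.
\<close>

lemma box_homI:
  assumes X: "is_rep R Q X" and Z: "is_rep R Q Z" and Y: "is_rep R Q Y"
    and ext: "f \<in> extensional (verts Q)"
    and hom: "\<And>i. i \<in> verts Q \<Longrightarrow> f i \<in> mod_hom R (vmod (box R Q X Z) i) (vmod Y i)"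
    and pure: "\<And>\<alpha> x z. \<alpha> \<in> arcs Q \<Longrightarrow> x \<in> carrier (vmod X (tail Q \<alpha>)) \<Longrightarrow> z \<in> carrier (vmod Z (tail Q \<alpha>)) \<Longrightarrow>
      f (head Q \<alpha>) (rep_tensor X Z (head Q \<alpha>) (amap X \<alpha> x) (amap Z \<alpha> z))
        = amap Y \<alpha> (f (tail Q \<alpha>) (rep_tensor X Z (tail Q \<alpha>) x z))"
  shows "f \<in> rep_hom R Q (box R Q X Z) Y"
proof (rule rep_homI[OF ext hom])
  fix \<alpha> t assume a: "\<alpha> \<in> arcs Q" and t: "t \<in> carrier (vmod (box R Q X Z) (tail Q \<alpha>))"
  let ?i = "tail Q \<alpha>" and ?j = "head Q \<alpha>"
  let ?T = "vmod (box R Q X Z) ?i"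
  note B = box_is_rep[OF X Z]
  have i: "?i \<in> verts Q" and j: "?j \<in> verts Q" using a by simp_all
  have "compose (carrier ?T) (f ?j) (amap (box R Q X Z) \<alpha>) = compose (carrier ?T) (amap Y \<alpha>) (f ?i)"
    unfolding box_simps(1)
  proof (rule tensor_hom_eqI[OF rep_module[OF X i] rep_module[OF Z i] rep_module[OF Y j]], fold box_simps(1)[of X Z])
    show "compose (carrier ?T) (f ?j) (amap (box R Q X Z) \<alpha>) \<in> mod_hom R ?T (vmod Y ?j)"
      by (rule mod_hom_compose[OF rep_module[OF B i] rep_amap[OF B a] hom[OF j]])
    show "compose (carrier ?T) (amap Y \<alpha>) (f ?i) \<in> mod_hom R ?T (vmod Y ?j)"
      by (rule mod_hom_compose[OF rep_module[OF B i] hom[OF i] rep_amap[OF Y a]])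
  qed (simp add: compose_def rep_tensor_closed[OF X Z i] box_amap_pure[OF X Z a] pure[OF a])
  from fun_cong[OF this, of t] t show "f ?j (amap (box R Q X Z) \<alpha> t) = amap Y \<alpha> (f ?i t)"
    by (simp add: compose_def)
qed

lemma box_hom_eqI:
  assumes X: "is_rep R Q X" and Z: "is_rep R Q Z" and Y: "is_rep R Q Y"
    and f: "f \<in> rep_hom R Q (box R Q X Z) Y" and g: "g \<in> rep_hom R Q (box R Q X Z) Y"
    and "\<And>i x z. i \<in> verts Q \<Longrightarrow> x \<in> carrier (vmod X i) \<Longrightarrow> z \<in> carrier (vmod Z i) \<Longrightarrow>
      f i (rep_tensor X Z i x z) = g i (rep_tensor X Z i x z)"
  shows "f = g"
proof (rule extensionalityI[OF rep_hom_extensional[OF f] rep_hom_extensional[OF g]])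
  fix i assume i: "i \<in> verts Q"
  show "f i = g i"
    using rep_hom_vertex[OF f i] rep_hom_vertex[OF g i] assms(6)[OF i] unfolding box_simps
    by (rule tensor_hom_eqI[OF X[THEN rep_module, OF i] Z[THEN rep_module, OF i] Y[THEN rep_module, OF i]])
qed

lemma box_map_pure:
  assumes X: "is_rep R Q X" and Z: "is_rep R Q Z" and Z': "is_rep R Q Z'" and g: "g \<in> rep_hom R Q Z Z'"
    and i: "i \<in> verts Q" and x: "x \<in> carrier (vmod X i)" and z: "z \<in> carrier (vmod Z i)"
  shows "box_map R Q X Z Z' g i (rep_tensor X Z i x z) = rep_tensor X Z' i x (g i z)"
  using i x tensor_map_pure[OF X[THEN rep_module, OF i] Z[THEN rep_module, OF i]
      X[THEN rep_module, OF i] Z'[THEN rep_module, OF i] rep_id_vertex[OF X i] rep_hom_vertex[OF g i] x z]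
  by (simp add: box_map_def rep_id_def)

lemma box_map_hom:
  assumes X: "is_rep R Q X" and Z: "is_rep R Q Z" and Z': "is_rep R Q Z'" and g: "g \<in> rep_hom R Q Z Z'"
  shows "box_map R Q X Z Z' g \<in> rep_hom R Q (box R Q X Z) (box R Q X Z')"
proof (rule box_homI[OF X Z box_is_rep[OF X Z']])
  show "box_map R Q X Z Z' g \<in> extensional (verts Q)" by (simp add: box_map_def)
  show "box_map R Q X Z Z' g i \<in> mod_hom R (vmod (box R Q X Z) i) (vmod (box R Q X Z') i)" if i: "i \<in> verts Q" for i
    using i tensor_map_mod_hom[OF X[THEN rep_module, OF i] Z[THEN rep_module, OF i]
        X[THEN rep_module, OF i] Z'[THEN rep_module, OF i] rep_id_vertex[OF X i] rep_hom_vertex[OF g i]]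
    by (simp add: box_map_def box_simps)
qed (simp add: box_map_pure[OF assms] box_amap_pure[OF X Z'] rep_amap_closed[OF X] rep_amap_closed[OF Z]
    rep_hom_closed[OF g] rep_hom_natural[OF g])


section \<open>Projective representations\<close>

abbreviation paths :: "'v \<Rightarrow> 'v \<Rightarrow> 'e list set" where
  "paths i k \<equiv> {p. pre_digraph.awalk Q i p k}"

lemma paths_Nil: "i \<in> verts Q \<Longrightarrow> [] \<in> paths i i"
  by (simp add: wf_digraph.awalk_Nil_iff[OF quiver])

lemma paths_Cons_iff:
  "\<alpha> # p \<in> paths i k \<longleftrightarrow> \<alpha> \<in> arcs Q \<and> i = tail Q \<alpha> \<and> p \<in> paths (head Q \<alpha>) k"
  by (simp add: wf_digraph.awalk_Cons_iff[OF quiver])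

lemma paths_snoc: "\<alpha> \<in> arcs Q \<Longrightarrow> p \<in> paths i (tail Q \<alpha>) \<Longrightarrow> p @ [\<alpha>] \<in> paths i (head Q \<alpha>)"
proof (induction p arbitrary: i)
  case Nil
  then show ?case
    by (simp add: wf_digraph.awalk_Nil_iff[OF quiver] wf_digraph.awalk_Cons_iff[OF quiver])
next
  case (Cons \<beta> p)
  then show ?case by (simp only: append_Cons paths_Cons_iff simp_thms)
qed

lemma paths_vert: "p \<in> paths i k \<Longrightarrow> i \<in> verts Q" "p \<in> paths i k \<Longrightarrow> k \<in> verts Q"
  using wf_digraph.awalk_hd_in_verts[OF quiver] wf_digraph.awalk_last_in_verts[OF quiver] by auto

lemma proj_rep_simps:
  "vmod (proj_rep R Q i) k = free_mod R (paths i k)"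
  "amap (proj_rep R Q i) \<alpha> = (\<lambda>u\<in>carrier (free_mod R (paths i (tail Q \<alpha>))). free_map R (\<lambda>p. p @ [\<alpha>]) u)"
  by (simp_all add: proj_rep_def)

abbreviation path_gen :: "'e list \<Rightarrow> 'e list \<Rightarrow> 'a" where
  "path_gen \<equiv> free_gen R"

lemma path_gen_closed: "p \<in> paths i k \<Longrightarrow> path_gen p \<in> carrier (vmod (proj_rep R Q i) k)"
  unfolding proj_rep_simps by (rule free_gen_carrier[OF ring])

lemma proj_rep_is_rep: "is_rep R Q (proj_rep R Q i)"
  unfolding is_rep_def
proof (intro conjI ballI)
  show "module R (vmod (proj_rep R Q i) k)" for k
    unfolding proj_rep_simps by (rule free_mod_module[OF ring])
  show "amap (proj_rep R Q i) \<alpha> \<in> mod_hom R (vmod (proj_rep R Q i) (tail Q \<alpha>)) (vmod (proj_rep R Q i) (head Q \<alpha>))"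
    if "\<alpha> \<in> arcs Q" for \<alpha>
    unfolding proj_rep_simps using paths_snoc[OF that] by (intro free_map_mod_hom[OF ring] Pi_I)
qed

lemma proj_amap_gen:
  assumes "\<alpha> \<in> arcs Q" and p: "p \<in> paths i (tail Q \<alpha>)"
  shows "amap (proj_rep R Q i) \<alpha> (path_gen p) = path_gen (p @ [\<alpha>])"
  using free_gen_carrier[OF ring p] free_map_gen[OF ring _ p, of "\<lambda>p. p @ [\<alpha>]" "paths i (head Q \<alpha>)"]
    paths_snoc[OF assms(1)] by (simp add: proj_rep_simps Pi_iff)

lemma proj_vertex_hom_eqI:
  assumes "module R M"
    and "g \<in> mod_hom R (vmod (proj_rep R Q i) k) M" and "h \<in> mod_hom R (vmod (proj_rep R Q i) k) M"
    and "\<And>p. p \<in> paths i k \<Longrightarrow> g (path_gen p) = h (path_gen p)"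
  shows "g = h"
  using assms unfolding proj_rep_simps(1) by (rule free_mod_hom_eqI)

text \<open>
  Both ways around the square of an arrow are linear and \<open>P(i)\<close> is free on paths at every vertex, so
  naturality may be checked on paths.
\<close>

lemma proj_homI:
  assumes Z: "is_rep R Q Z" and ext: "f \<in> extensional (verts Q)"
    and hom: "\<And>k. k \<in> verts Q \<Longrightarrow> f k \<in> mod_hom R (vmod (proj_rep R Q i) k) (vmod Z k)"
    and gen: "\<And>\<alpha> p. \<alpha> \<in> arcs Q \<Longrightarrow> p \<in> paths i (tail Q \<alpha>) \<Longrightarrow>
      f (head Q \<alpha>) (path_gen (p @ [\<alpha>])) = amap Z \<alpha> (f (tail Q \<alpha>) (path_gen p))"
  shows "f \<in> rep_hom R Q (proj_rep R Q i) Z"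
proof (rule rep_homI[OF ext hom])
  fix \<alpha> u assume a: "\<alpha> \<in> arcs Q" and u: "u \<in> carrier (vmod (proj_rep R Q i) (tail Q \<alpha>))"
  let ?P = "vmod (proj_rep R Q i) (tail Q \<alpha>)"
  have t: "tail Q \<alpha> \<in> verts Q" and h: "head Q \<alpha> \<in> verts Q" using a by simp_all
  have "compose (carrier ?P) (f (head Q \<alpha>)) (amap (proj_rep R Q i) \<alpha>)
      = compose (carrier ?P) (amap Z \<alpha>) (f (tail Q \<alpha>))"
  proof (rule proj_vertex_hom_eqI[OF rep_module[OF Z h]])
    show "compose (carrier ?P) (f (head Q \<alpha>)) (amap (proj_rep R Q i) \<alpha>) \<in> mod_hom R ?P (vmod Z (head Q \<alpha>))"
      by (rule mod_hom_compose[OF rep_module[OF proj_rep_is_rep t] rep_amap[OF proj_rep_is_rep a] hom[OF h]])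
    show "compose (carrier ?P) (amap Z \<alpha>) (f (tail Q \<alpha>)) \<in> mod_hom R ?P (vmod Z (head Q \<alpha>))"
      by (rule mod_hom_compose[OF rep_module[OF proj_rep_is_rep t] hom[OF t] rep_amap[OF Z a]])
  qed (simp add: compose_def path_gen_closed proj_amap_gen[OF a] gen[OF a] del: mem_Collect_eq)
  from fun_cong[OF this, of u] u
  show "f (head Q \<alpha>) (amap (proj_rep R Q i) \<alpha> u) = amap Z \<alpha> (f (tail Q \<alpha>) u)"
    by (simp add: compose_def)
qed

text \<open>
  An element of the internal hom at \<open>i\<close> is determined by its values on the tensors \<open>x \<otimes> p\<close> with \<open>p\<close> a
  path starting at \<open>i\<close>. The adjunction is verified on these tensors.
\<close>

lemma box_proj_hom_eqI:
  assumes X: "is_rep R Q X" and Y: "is_rep R Q Y"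
    and f: "f \<in> rep_hom R Q (box R Q X (proj_rep R Q i)) Y"
    and g: "g \<in> rep_hom R Q (box R Q X (proj_rep R Q i)) Y"
    and gen: "\<And>k x p. k \<in> verts Q \<Longrightarrow> x \<in> carrier (vmod X k) \<Longrightarrow> p \<in> paths i k \<Longrightarrow>
      f k (rep_tensor X (proj_rep R Q i) k x (path_gen p)) = g k (rep_tensor X (proj_rep R Q i) k x (path_gen p))"
  shows "f = g"
proof (rule box_hom_eqI[OF X proj_rep_is_rep Y f g])
  fix k x u assume k: "k \<in> verts Q" and x: "x \<in> carrier (vmod X k)"
    and u: "u \<in> carrier (vmod (proj_rep R Q i) k)"
  let ?P = "vmod (proj_rep R Q i) k"
  note P = rep_module[OF proj_rep_is_rep[of i] k]
  interpret P: module R ?P by (rule P)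
  let ?x = "\<lambda>h. \<lambda>u\<in>carrier ?P. h k (rep_tensor X (proj_rep R Q i) k x u)"
  have hom: "?x h \<in> mod_hom R ?P (vmod Y k)" if h: "h \<in> rep_hom R Q (box R Q X (proj_rep R Q i)) Y" for h
    using rep_tensor_bilinear[OF X proj_rep_is_rep[of i] k] x
    by (intro mod_homI) (auto simp: restrict_PiE_iff bilinear_map_def rep_hom_closed[OF h k]
      mod_hom_add[OF rep_hom_vertex[OF h k]] mod_hom_smult[OF rep_hom_vertex[OF h k]])
  have "?x f = ?x g"
  proof (rule proj_vertex_hom_eqI[OF rep_module[OF Y k] hom[OF f] hom[OF g]])
    show "?x f (path_gen p) = ?x g (path_gen p)" if "p \<in> paths i k" for p
      using path_gen_closed[OF that] gen[OF k x that] by simp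
  qed
  from fun_cong[OF this, of u] u
  show "f k (rep_tensor X (proj_rep R Q i) k x u) = g k (rep_tensor X (proj_rep R Q i) k x u)"
    by simp
qed

lemma
  assumes a: "\<alpha> \<in> arcs Q"
  shows proj_incl_hom: "proj_incl R Q \<alpha> \<in> rep_hom R Q (proj_rep R Q (head Q \<alpha>)) (proj_rep R Q (tail Q \<alpha>))"
    and proj_incl_gen: "p \<in> paths (head Q \<alpha>) k \<Longrightarrow> proj_incl R Q \<alpha> k (path_gen p) = path_gen (\<alpha> # p)"
proof -
  have map: "(\<lambda>p. \<alpha> # p) \<in> paths (head Q \<alpha>) k \<rightarrow> paths (tail Q \<alpha>) k" for k
    using a paths_Cons_iff by blast
  show gen: "proj_incl R Q \<alpha> k (path_gen p) = path_gen (\<alpha> # p)" if p: "p \<in> paths (head Q \<alpha>) k" for k p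
    using paths_vert[OF p] path_gen_closed[OF p] free_map_gen[OF ring map p] by (simp add: proj_incl_def)
  show "proj_incl R Q \<alpha> \<in> rep_hom R Q (proj_rep R Q (head Q \<alpha>)) (proj_rep R Q (tail Q \<alpha>))"
  proof (rule proj_homI[OF proj_rep_is_rep])
    show "proj_incl R Q \<alpha> \<in> extensional (verts Q)" by (simp add: proj_incl_def)
    show "proj_incl R Q \<alpha> k \<in> mod_hom R (vmod (proj_rep R Q (head Q \<alpha>)) k) (vmod (proj_rep R Q (tail Q \<alpha>)) k)"
      if "k \<in> verts Q" for k
      using that free_map_mod_hom[OF ring map] by (simp add: proj_incl_def proj_rep_simps)
  next
    fix \<beta> p assume b: "\<beta> \<in> arcs Q" and p: "p \<in> paths (head Q \<alpha>) (tail Q \<beta>)"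
    have "\<alpha> # p \<in> paths (tail Q \<alpha>) (tail Q \<beta>)" using a p paths_Cons_iff by blast
    then show "proj_incl R Q \<alpha> (head Q \<beta>) (path_gen (p @ [\<beta>]))
        = amap (proj_rep R Q (tail Q \<alpha>)) \<beta> (proj_incl R Q \<alpha> (tail Q \<beta>) (path_gen p))"
      using proj_amap_gen[OF b] gen[OF p] gen[OF paths_snoc[OF b p]] by simp
  qed
qed

lemma path_map_closed:
  assumes "is_rep R Q Z" and "p \<in> paths i k" and "z \<in> carrier (vmod Z i)"
  shows "fold (amap Z) p z \<in> carrier (vmod Z k)"
  using assms(2,3)
proof (induction p arbitrary: i z)
  case Nil
  then show ?case by (simp add: wf_digraph.awalk_Nil_iff[OF quiver])
next
  case (Cons \<alpha> p)
  from Cons.prems(1) have "\<alpha> \<in> arcs Q" "i = tail Q \<alpha>" "p \<in> paths (head Q \<alpha>) k"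
    by (simp_all only: paths_Cons_iff)
  then show ?case using Cons.IH Cons.prems(2) rep_amap_closed[OF assms(1)] by simp
qed

lemma path_map_add:
  assumes Z: "is_rep R Q Z" and "p \<in> paths i k" and "z \<in> carrier (vmod Z i)" and "z' \<in> carrier (vmod Z i)"
  shows "fold (amap Z) p (z \<oplus>\<^bsub>vmod Z i\<^esub> z') = fold (amap Z) p z \<oplus>\<^bsub>vmod Z k\<^esub> fold (amap Z) p z'"
  using assms(2-)
proof (induction p arbitrary: i z z')
  case Nil
  then show ?case by (simp add: wf_digraph.awalk_Nil_iff[OF quiver])
next
  case (Cons \<alpha> p)
  from Cons.prems(1) have "\<alpha> \<in> arcs Q" "i = tail Q \<alpha>" "p \<in> paths (head Q \<alpha>) k"
    by (simp_all only: paths_Cons_iff)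
  then show ?case
    using Cons.IH Cons.prems(2,3) rep_amap_closed[OF Z] mod_hom_add[OF rep_amap[OF Z]] by simp
qed

lemma path_map_smult:
  assumes Z: "is_rep R Q Z" and "p \<in> paths i k" and "z \<in> carrier (vmod Z i)" and r: "r \<in> carrier R"
  shows "fold (amap Z) p (r \<odot>\<^bsub>vmod Z i\<^esub> z) = r \<odot>\<^bsub>vmod Z k\<^esub> fold (amap Z) p z"
  using assms(2,3)
proof (induction p arbitrary: i z)
  case Nil
  then show ?case by (simp add: wf_digraph.awalk_Nil_iff[OF quiver])
next
  case (Cons \<alpha> p)
  from Cons.prems(1) have "\<alpha> \<in> arcs Q" "i = tail Q \<alpha>" "p \<in> paths (head Q \<alpha>) k"
    by (simp_all only: paths_Cons_iff)
  then show ?case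
    using Cons.IH Cons.prems(2) r rep_amap_closed[OF Z] mod_hom_smult[OF rep_amap[OF Z]] by simp
qed

lemma path_map_natural:
  assumes Z: "is_rep R Q Z" and h: "h \<in> rep_hom R Q Z Z'" and "p \<in> paths i k" and "z \<in> carrier (vmod Z i)"
  shows "h k (fold (amap Z) p z) = fold (amap Z') p (h i z)"
  using assms(3-)
proof (induction p arbitrary: i z)
  case Nil
  then show ?case by (simp add: wf_digraph.awalk_Nil_iff[OF quiver])
next
  case (Cons \<alpha> p)
  from Cons.prems(1) have "\<alpha> \<in> arcs Q" "i = tail Q \<alpha>" "p \<in> paths (head Q \<alpha>) k"
    by (simp_all only: paths_Cons_iff)
  then show ?case
    using Cons.IH Cons.prems(2) rep_amap_closed[OF Z] rep_hom_natural[OF h] by simp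
qed

lemma
  assumes Z: "is_rep R Q Z" and z: "z \<in> carrier (vmod Z i)"
  shows yoneda_hom: "yoneda R Q Z i z \<in> rep_hom R Q (proj_rep R Q i) Z"
    and yoneda_gen: "p \<in> paths i k \<Longrightarrow> yoneda R Q Z i z k (path_gen p) = fold (amap Z) p z"
proof -
  have yoneda: "yoneda R Q Z i z k = (\<lambda>u\<in>carrier (free_mod R (paths i k)). lin_ext R (vmod Z k) (\<lambda>p. fold (amap Z) p z) u)"
    if "k \<in> verts Q" for k
    using that by (simp add: yoneda_def proj_rep_simps lin_ext_def)
  have map: "(\<lambda>p. fold (amap Z) p z) \<in> paths i k \<rightarrow> carrier (vmod Z k)" for k
    using path_map_closed[OF Z _ z] by (intro Pi_I)
  show gen: "yoneda R Q Z i z k (path_gen p) = fold (amap Z) p z" if p: "p \<in> paths i k" for p k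
    using yoneda[OF paths_vert(2)[OF p]] lin_ext_gen[OF rep_module[OF Z paths_vert(2)[OF p]] map p]
      free_gen_carrier[OF ring p] by simp
  show "yoneda R Q Z i z \<in> rep_hom R Q (proj_rep R Q i) Z"
  proof (rule proj_homI[OF Z])
    show "yoneda R Q Z i z \<in> extensional (verts Q)" by (simp add: yoneda_def)
    show "yoneda R Q Z i z k \<in> mod_hom R (vmod (proj_rep R Q i) k) (vmod Z k)" if "k \<in> verts Q" for k
      unfolding proj_rep_simps yoneda[OF that] by (rule lin_ext_mod_hom[OF rep_module[OF Z that] map])
  next
    fix \<alpha> p assume a: "\<alpha> \<in> arcs Q" and p: "p \<in> paths i (tail Q \<alpha>)"
    show "yoneda R Q Z i z (head Q \<alpha>) (path_gen (p @ [\<alpha>])) = amap Z \<alpha> (yoneda R Q Z i z (tail Q \<alpha>) (path_gen p))"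
      using gen[OF p] gen[OF paths_snoc[OF a p]] by simp
  qed
qed


section \<open>The internal hom\<close>

lemma internal_hom_simps:
  "vmod (internal_hom R Q X Y) i = hom_mod R Q (box R Q X (proj_rep R Q i)) Y"
  "amap (internal_hom R Q X Y) \<alpha> = (\<lambda>\<phi>\<in>rep_hom R Q (box R Q X (proj_rep R Q (tail Q \<alpha>))) Y.
       rep_comp Q (box R Q X (proj_rep R Q (head Q \<alpha>))) \<phi>
         (box_map R Q X (proj_rep R Q (head Q \<alpha>)) (proj_rep R Q (tail Q \<alpha>)) (proj_incl R Q \<alpha>)))"
  by (simp_all add: internal_hom_def)

lemma internal_hom_carrier:
  "carrier (vmod (internal_hom R Q X Y) i) = rep_hom R Q (box R Q X (proj_rep R Q i)) Y"
  by (simp add: internal_hom_simps hom_mod_simps)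

lemma internal_hom_is_rep:
  assumes X: "is_rep R Q X" and Y: "is_rep R Q Y"
  shows "is_rep R Q (internal_hom R Q X Y)"
  unfolding is_rep_def internal_hom_simps
  by (intro conjI ballI hom_mod_module precomp_mod_hom box_map_hom box_is_rep proj_rep_is_rep proj_incl_hom assms)

text \<open>
  Right multiplication by \<open>\<alpha>\<close> puts \<open>\<alpha>\<close> in front of the list of arcs. This shift of the path is all
  that precomposition with \<open>id \<box> \<iota>\<^sub>\<alpha>\<close> does.
\<close>

lemma internal_hom_amap_gen:
  assumes X: "is_rep R Q X" and a: "\<alpha> \<in> arcs Q"
    and \<phi>: "\<phi> \<in> rep_hom R Q (box R Q X (proj_rep R Q (tail Q \<alpha>))) Y"
    and x: "x \<in> carrier (vmod X k)" and p: "p \<in> paths (head Q \<alpha>) k"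
  shows "amap (internal_hom R Q X Y) \<alpha> \<phi> k (rep_tensor X (proj_rep R Q (head Q \<alpha>)) k x (path_gen p))
    = \<phi> k (rep_tensor X (proj_rep R Q (tail Q \<alpha>)) k x (path_gen (\<alpha> # p)))"
  using \<phi> paths_vert(2)[OF p]
  by (simp add: internal_hom_simps rep_tensor_closed[OF X proj_rep_is_rep _ x path_gen_closed[OF p]]
    box_map_pure[OF X proj_rep_is_rep proj_rep_is_rep proj_incl_hom[OF a] _ x path_gen_closed[OF p]]
    proj_incl_gen[OF a p])

lemma internal_hom_map_hom:
  assumes X: "is_rep R Q X" and Y: "is_rep R Q Y" and Y': "is_rep R Q Y'" and g: "g \<in> rep_hom R Q Y Y'"
  shows "internal_hom_map R Q X Y g \<in> rep_hom R Q (internal_hom R Q X Y) (internal_hom R Q X Y')"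
proof (rule rep_homI)
  show "internal_hom_map R Q X Y g \<in> extensional (verts Q)" by (simp add: internal_hom_map_def)
  show "internal_hom_map R Q X Y g i \<in> mod_hom R (vmod (internal_hom R Q X Y) i) (vmod (internal_hom R Q X Y') i)"
    if "i \<in> verts Q" for i
    using that postcomp_mod_hom[OF box_is_rep[OF X proj_rep_is_rep] Y Y' g]
    by (simp add: internal_hom_map_def internal_hom_simps)
next
  fix \<alpha> \<phi> assume a: "\<alpha> \<in> arcs Q" and "\<phi> \<in> carrier (vmod (internal_hom R Q X Y) (tail Q \<alpha>))"
  then have \<phi>: "\<phi> \<in> rep_hom R Q (box R Q X (proj_rep R Q (tail Q \<alpha>))) Y" by (simp add: internal_hom_carrier)
  let ?P = "\<lambda>i. box R Q X (proj_rep R Q i)"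
  let ?\<iota> = "box_map R Q X (proj_rep R Q (head Q \<alpha>)) (proj_rep R Q (tail Q \<alpha>)) (proj_incl R Q \<alpha>)"
  note P = box_is_rep[OF X proj_rep_is_rep]
  have \<iota>: "?\<iota> \<in> rep_hom R Q (?P (head Q \<alpha>)) (?P (tail Q \<alpha>))"
    by (rule box_map_hom[OF X proj_rep_is_rep proj_rep_is_rep proj_incl_hom[OF a]])
  show "internal_hom_map R Q X Y g (head Q \<alpha>) (amap (internal_hom R Q X Y) \<alpha> \<phi>)
      = amap (internal_hom R Q X Y') \<alpha> (internal_hom_map R Q X Y g (tail Q \<alpha>) \<phi>)"
    using a \<phi> rep_comp_hom[OF P \<iota> \<phi>] rep_comp_hom[OF P \<phi> g] rep_comp_assoc[OF \<iota>, of g \<phi>]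
    by (simp add: internal_hom_simps internal_hom_map_def)
qed


section \<open>The adjunction\<close>

text \<open>
  The Yoneda morphism of \<open>z\<close> sends \<open>p\<close> to \<open>Z\<^sub>p z\<close>, and \<open>id \<box> yoneda\<close> applies it to the second factor of a
  pure tensor. By \<open>box_proj_hom_eqI\<close> the resulting values determine the transpose, which makes
  this formula the working description of the adjunction.
\<close>

lemma
  assumes X: "is_rep R Q X" and Z: "is_rep R Q Z" and f: "f \<in> rep_hom R Q (box R Q X Z) Y"
    and i: "i \<in> verts Q" and z: "z \<in> carrier (vmod Z i)"
  shows transpose_hom_value:
      "transpose_hom R Q X Z f i z \<in> rep_hom R Q (box R Q X (proj_rep R Q i)) Y"
    and transpose_hom_pure: "k \<in> verts Q \<Longrightarrow> x \<in> carrier (vmod X k) \<Longrightarrow> p \<in> paths i k \<Longrightarrow>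
      transpose_hom R Q X Z f i z k (rep_tensor X (proj_rep R Q i) k x (path_gen p))
        = f k (rep_tensor X Z k x (fold (amap Z) p z))"
proof -
  note y = yoneda_hom[OF Z z]
  show "transpose_hom R Q X Z f i z \<in> rep_hom R Q (box R Q X (proj_rep R Q i)) Y"
    using i z rep_comp_hom[OF box_is_rep[OF X proj_rep_is_rep] box_map_hom[OF X proj_rep_is_rep Z y] f]
    by (simp add: transpose_hom_def)
  show "transpose_hom R Q X Z f i z k (rep_tensor X (proj_rep R Q i) k x (path_gen p))
      = f k (rep_tensor X Z k x (fold (amap Z) p z))"
    if k: "k \<in> verts Q" and x: "x \<in> carrier (vmod X k)" and p: "p \<in> paths i k"
    using i z k by (simp add: transpose_hom_def rep_tensor_closed[OF X proj_rep_is_rep k x path_gen_closed[OF p]]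
      box_map_pure[OF X proj_rep_is_rep Z y k x path_gen_closed[OF p]] yoneda_gen[OF Z z p])
qed

text \<open>
  Linearity in \<open>z\<close> holds because \<open>z \<mapsto> f (x \<otimes> Z\<^sub>p z)\<close> is linear. Naturality along \<open>\<alpha>\<close> is the identity
  \<open>Z\<^sub>p (Z\<^sub>\<alpha> z) = Z\<^sub>q z\<close> for the path \<open>q\<close> that traverses \<open>\<alpha>\<close> and then \<open>p\<close>.
\<close>

lemma transpose_hom_hom:
  assumes X: "is_rep R Q X" and Y: "is_rep R Q Y" and Z: "is_rep R Q Z" and f: "f \<in> rep_hom R Q (box R Q X Z) Y"
  shows "transpose_hom R Q X Z f \<in> rep_hom R Q Z (internal_hom R Q X Y)"
proof (rule rep_homI)
  note val = transpose_hom_value[OF X Z f] and pure = transpose_hom_pure[OF X Z f]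
  show "transpose_hom R Q X Z f \<in> extensional (verts Q)" by (simp add: transpose_hom_def)
  fix i assume i: "i \<in> verts Q"
  let ?H = "vmod (internal_hom R Q X Y) i"
  interpret Zi: module R "vmod Z i" by (rule rep_module[OF Z i])
  interpret H: module R ?H by (rule rep_module[OF internal_hom_is_rep[OF X Y] i])
  have eqI: "\<phi> = \<psi>" if "\<phi> \<in> carrier ?H" "\<psi> \<in> carrier ?H"
    "\<And>k x p. k \<in> verts Q \<Longrightarrow> x \<in> carrier (vmod X k) \<Longrightarrow> p \<in> paths i k \<Longrightarrow>
      \<phi> k (rep_tensor X (proj_rep R Q i) k x (path_gen p)) = \<psi> k (rep_tensor X (proj_rep R Q i) k x (path_gen p))"
    for \<phi> \<psi>
    using that unfolding internal_hom_carrier by (rule box_proj_hom_eqI[OF X Y])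
  have closed: "transpose_hom R Q X Z f i z \<in> carrier ?H" if "z \<in> carrier (vmod Z i)" for z
    using val[OF i that] by (simp add: internal_hom_carrier)
  note tens = rep_tensor_closed[OF X proj_rep_is_rep _ _ path_gen_closed]
    rep_tensor_closed[OF X Z _ _ path_map_closed[OF Z]] path_map_closed[OF Z]
  have bil: "bilinear_map R (vmod X k) (vmod Z k) (vmod (box R Q X Z) k) (rep_tensor X Z k)" if "k \<in> verts Q" for k
    by (rule rep_tensor_bilinear[OF X Z that])
  show "transpose_hom R Q X Z f i \<in> mod_hom R (vmod Z i) ?H"
  proof (rule mod_homI)
    show "transpose_hom R Q X Z f i \<in> carrier (vmod Z i) \<rightarrow>\<^sub>E carrier ?H"
      using closed i by (auto simp: PiE_iff transpose_hom_def)
  next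
    fix z z' assume z: "z \<in> carrier (vmod Z i)" "z' \<in> carrier (vmod Z i)"
    show "transpose_hom R Q X Z f i (z \<oplus>\<^bsub>vmod Z i\<^esub> z')
        = transpose_hom R Q X Z f i z \<oplus>\<^bsub>?H\<^esub> transpose_hom R Q X Z f i z'"
    proof (rule eqI)
      fix k x p assume k: "k \<in> verts Q" and x: "x \<in> carrier (vmod X k)" and p: "p \<in> paths i k"
      have "f k (rep_tensor X Z k x (fold (amap Z) p z \<oplus>\<^bsub>vmod Z k\<^esub> fold (amap Z) p z'))
          = f k (rep_tensor X Z k x (fold (amap Z) p z)) \<oplus>\<^bsub>vmod Y k\<^esub> f k (rep_tensor X Z k x (fold (amap Z) p z'))"
        using bil[OF k] x tens(3)[OF p] z
        by (simp add: bilinear_map_def mod_hom_add[OF rep_hom_vertex[OF f k]])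
      then show "transpose_hom R Q X Z f i (z \<oplus>\<^bsub>vmod Z i\<^esub> z') k (rep_tensor X (proj_rep R Q i) k x (path_gen p))
          = (transpose_hom R Q X Z f i z \<oplus>\<^bsub>?H\<^esub> transpose_hom R Q X Z f i z') k (rep_tensor X (proj_rep R Q i) k x (path_gen p))"
        using pure[OF i _ k x p] z k tens(1)[OF k x p] path_map_add[OF Z p z]
        by (simp add: internal_hom_simps hom_mod_simps)
    qed (intro closed H.add.m_closed Zi.add.m_closed z)+
  next
    fix r z assume r: "r \<in> carrier R" and z: "z \<in> carrier (vmod Z i)"
    show "transpose_hom R Q X Z f i (r \<odot>\<^bsub>vmod Z i\<^esub> z) = r \<odot>\<^bsub>?H\<^esub> transpose_hom R Q X Z f i z"
    proof (rule eqI)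
      fix k x p assume k: "k \<in> verts Q" and x: "x \<in> carrier (vmod X k)" and p: "p \<in> paths i k"
      have "f k (rep_tensor X Z k x (r \<odot>\<^bsub>vmod Z k\<^esub> fold (amap Z) p z))
          = r \<odot>\<^bsub>vmod Y k\<^esub> f k (rep_tensor X Z k x (fold (amap Z) p z))"
        using bil[OF k] r x tens(3)[OF p z]
        by (simp add: bilinear_map_def mod_hom_smult[OF rep_hom_vertex[OF f k]])
      then show "transpose_hom R Q X Z f i (r \<odot>\<^bsub>vmod Z i\<^esub> z) k (rep_tensor X (proj_rep R Q i) k x (path_gen p))
          = (r \<odot>\<^bsub>?H\<^esub> transpose_hom R Q X Z f i z) k (rep_tensor X (proj_rep R Q i) k x (path_gen p))"
        using pure[OF i _ k x p] r z k tens(1)[OF k x p] path_map_smult[OF Z p z r]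
        by (simp add: internal_hom_simps hom_mod_simps)
    qed (intro closed H.smult_closed Zi.smult_closed z r)+
  qed
next
  note val = transpose_hom_value[OF X Z f] and pure = transpose_hom_pure[OF X Z f]
  fix \<alpha> z assume a: "\<alpha> \<in> arcs Q" and z: "z \<in> carrier (vmod Z (tail Q \<alpha>))"
  have t: "tail Q \<alpha> \<in> verts Q" and h: "head Q \<alpha> \<in> verts Q" using a by simp_all
  note z' = rep_amap_closed[OF Z a z]
  show "transpose_hom R Q X Z f (head Q \<alpha>) (amap Z \<alpha> z)
      = amap (internal_hom R Q X Y) \<alpha> (transpose_hom R Q X Z f (tail Q \<alpha>) z)"
  proof (rule box_proj_hom_eqI[OF X Y val[OF h z']])
    show "amap (internal_hom R Q X Y) \<alpha> (transpose_hom R Q X Z f (tail Q \<alpha>) z)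
        \<in> rep_hom R Q (box R Q X (proj_rep R Q (head Q \<alpha>))) Y"
      using rep_amap_closed[OF internal_hom_is_rep[OF X Y] a] val[OF t z]
      by (simp add: internal_hom_carrier)
  next
    fix k x p assume k: "k \<in> verts Q" and x: "x \<in> carrier (vmod X k)" and p: "p \<in> paths (head Q \<alpha>) k"
    have "\<alpha> # p \<in> paths (tail Q \<alpha>) k" using a p paths_Cons_iff by blast
    from pure[OF t z k x this] pure[OF h z' k x p]
    show "transpose_hom R Q X Z f (head Q \<alpha>) (amap Z \<alpha> z) k (rep_tensor X (proj_rep R Q (head Q \<alpha>)) k x (path_gen p))
        = amap (internal_hom R Q X Y) \<alpha> (transpose_hom R Q X Z f (tail Q \<alpha>) z) k
            (rep_tensor X (proj_rep R Q (head Q \<alpha>)) k x (path_gen p))"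
      by (simp add: internal_hom_amap_gen[OF X a val[OF t z] x p])
  qed
qed

text \<open>
  At a trivial path the formula for the transpose reads \<open>x \<otimes> [] \<mapsto> f (x \<otimes> z)\<close>, so evaluation there
  recovers \<open>f\<close>.
\<close>

definition untranspose ::
    "('v, 'e, 'a, 'x) qrep \<Rightarrow> ('v, 'e, 'a, 'y) qrep \<Rightarrow> ('v, 'e, 'a, 'z) qrep
      \<Rightarrow> ('v \<Rightarrow> 'z \<Rightarrow> 'v \<Rightarrow> ('x \<times> ('e list \<Rightarrow> 'a) \<Rightarrow> 'a) set \<Rightarrow> 'y) \<Rightarrow> 'v \<Rightarrow> ('x \<times> 'z \<Rightarrow> 'a) set \<Rightarrow> 'y" where
  "untranspose X Y Z g = (\<lambda>i\<in>verts Q. tensor_lift R (vmod X i) (vmod Z i) (vmod Y i)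
      (\<lambda>x z. g i z i (rep_tensor X (proj_rep R Q i) i x (path_gen []))))"

text \<open>
  Naturality of \<open>g\<close> along the arrows of \<open>p\<close> moves the path out of the argument of \<open>g\<close>: the values of \<open>g\<close>
  at trivial paths determine its values at all paths.
\<close>

lemma path_translate:
  assumes X: "is_rep R Q X" and Z: "is_rep R Q Z" and g: "g \<in> rep_hom R Q Z (internal_hom R Q X Y)"
    and "p \<in> paths i k" and "z \<in> carrier (vmod Z i)" and x: "x \<in> carrier (vmod X k)"
  shows "g k (fold (amap Z) p z) k (rep_tensor X (proj_rep R Q k) k x (path_gen []))
    = g i z k (rep_tensor X (proj_rep R Q i) k x (path_gen p))"
  using assms(4,5)
proof (induction p arbitrary: i z)
  case Nil
  then show ?case by (simp add: wf_digraph.awalk_Nil_iff[OF quiver])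
next
  case (Cons \<alpha> p)
  from Cons.prems(1) have p: "\<alpha> \<in> arcs Q" "i = tail Q \<alpha>" "p \<in> paths (head Q \<alpha>) k"
    by (simp_all only: paths_Cons_iff)
  have z: "z \<in> carrier (vmod Z (tail Q \<alpha>))" using Cons.prems(2) p(2) by simp
  have "g (tail Q \<alpha>) z \<in> rep_hom R Q (box R Q X (proj_rep R Q (tail Q \<alpha>))) Y"
    using rep_hom_closed[OF g _ z] p(1) by (simp add: internal_hom_carrier)
  from internal_hom_amap_gen[OF X p(1) this x p(3)] Cons.IH[OF p(3) rep_amap_closed[OF Z p(1) z]]
  show ?case using p(2) rep_hom_natural[OF g p(1) z] by simp
qed

text \<open>
  The naturality square of an arrow \<open>\<alpha> : i \<rightarrow> j\<close> at \<open>x \<otimes> z\<close> combines two facts. By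
  \<open>path_translate\<close> for the path of length one, evaluating \<open>g (Z\<^sub>\<alpha> z)\<close> at \<open>X\<^sub>\<alpha> x \<otimes> []\<close> is evaluating
  \<open>g z\<close> at \<open>X\<^sub>\<alpha> x \<otimes> \<alpha>\<close>; and that tensor is the image of \<open>x \<otimes> []\<close> under the structure map of
  \<open>X \<box> P(i)\<close>, with which \<open>g z\<close> commutes.
\<close>

lemma
  assumes X: "is_rep R Q X" and Y: "is_rep R Q Y" and Z: "is_rep R Q Z" and g: "g \<in> rep_hom R Q Z (internal_hom R Q X Y)"
  shows untranspose_hom: "untranspose X Y Z g \<in> rep_hom R Q (box R Q X Z) Y"
    and untranspose_pure: "i \<in> verts Q \<Longrightarrow> x \<in> carrier (vmod X i) \<Longrightarrow> z \<in> carrier (vmod Z i) \<Longrightarrow>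
      untranspose X Y Z g i (rep_tensor X Z i x z) = g i z i (rep_tensor X (proj_rep R Q i) i x (path_gen []))"
proof -
  let ?b = "\<lambda>i x z. g i z i (rep_tensor X (proj_rep R Q i) i x (path_gen []))"
  have val: "g i z \<in> rep_hom R Q (box R Q X (proj_rep R Q i)) Y" if "i \<in> verts Q" "z \<in> carrier (vmod Z i)" for i z
    using rep_hom_closed[OF g that] by (simp add: internal_hom_carrier)
  note nil = path_gen_closed[OF paths_Nil]
  have bil: "bilinear_map R (vmod X i) (vmod Z i) (vmod Y i) (?b i)" if i: "i \<in> verts Q" for i
  proof -
    note tens = rep_tensor_closed[OF X proj_rep_is_rep i _ nil[OF i]]
    have tbil: "bilinear_map R (vmod X i) (vmod (proj_rep R Q i) i) (vmod (box R Q X (proj_rep R Q i)) i)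
        (rep_tensor X (proj_rep R Q i) i)"
      by (rule rep_tensor_bilinear[OF X proj_rep_is_rep i])
    have left: "?b i (x \<oplus>\<^bsub>vmod X i\<^esub> x') z = ?b i x z \<oplus>\<^bsub>vmod Y i\<^esub> ?b i x' z"
      if "x \<in> carrier (vmod X i)" "x' \<in> carrier (vmod X i)" "z \<in> carrier (vmod Z i)" for x x' z
      using tbil that tens nil[OF i]
      by (simp add: bilinear_map_def mod_hom_add[OF rep_hom_vertex[OF val[OF i that(3)] i]])
    have left_smult: "?b i (r \<odot>\<^bsub>vmod X i\<^esub> x) z = r \<odot>\<^bsub>vmod Y i\<^esub> ?b i x z"
      if "r \<in> carrier R" "x \<in> carrier (vmod X i)" "z \<in> carrier (vmod Z i)" for r x z
      using tbil that tens nil[OF i]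
      by (simp add: bilinear_map_def mod_hom_smult[OF rep_hom_vertex[OF val[OF i that(3)] i]])
    show ?thesis
      unfolding bilinear_map_def
      using i tens left left_smult
      by (simp add: rep_hom_closed[OF val] mod_hom_add[OF rep_hom_vertex[OF g i]]
        mod_hom_smult[OF rep_hom_vertex[OF g i]], simp add: internal_hom_simps hom_mod_simps)
  qed
  note lift = tensor_lift_mod_hom[OF X[THEN rep_module] Z[THEN rep_module] Y[THEN rep_module] bil]
    tensor_lift_pure[OF X[THEN rep_module] Z[THEN rep_module] Y[THEN rep_module] bil]
  show pure: "untranspose X Y Z g i (rep_tensor X Z i x z) = ?b i x z"
    if "i \<in> verts Q" "x \<in> carrier (vmod X i)" "z \<in> carrier (vmod Z i)" for i x z
    using that lift(2) by (simp add: untranspose_def)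
  show "untranspose X Y Z g \<in> rep_hom R Q (box R Q X Z) Y"
  proof (rule box_homI[OF X Z Y])
    show "untranspose X Y Z g \<in> extensional (verts Q)" by (simp add: untranspose_def)
    show "untranspose X Y Z g i \<in> mod_hom R (vmod (box R Q X Z) i) (vmod Y i)" if "i \<in> verts Q" for i
      using that lift(1) by (simp add: untranspose_def box_simps)
  next
    fix \<alpha> x z assume a: "\<alpha> \<in> arcs Q" and x: "x \<in> carrier (vmod X (tail Q \<alpha>))" and z: "z \<in> carrier (vmod Z (tail Q \<alpha>))"
    let ?i = "tail Q \<alpha>" and ?j = "head Q \<alpha>"
    have i: "?i \<in> verts Q" and j: "?j \<in> verts Q" using a by simp_all
    note x' = rep_amap_closed[OF X a x] and z' = rep_amap_closed[OF Z a z]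
    have path: "[\<alpha>] \<in> paths ?i ?j" using paths_snoc[OF a paths_Nil[OF i]] by simp
    have "?b ?j (amap X \<alpha> x) (amap Z \<alpha> z) = g ?i z ?j (rep_tensor X (proj_rep R Q ?i) ?j (amap X \<alpha> x) (path_gen [\<alpha>]))"
      using path_translate[OF X Z g path z x'] by simp
    also have "\<dots> = g ?i z ?j (amap (box R Q X (proj_rep R Q ?i)) \<alpha> (rep_tensor X (proj_rep R Q ?i) ?i x (path_gen [])))"
      using box_amap_pure[OF X proj_rep_is_rep a x nil[OF i]] proj_amap_gen[OF a paths_Nil[OF i]] by simp
    also have "\<dots> = amap Y \<alpha> (?b ?i x z)"
      by (rule rep_hom_natural[OF val[OF i z] a rep_tensor_closed[OF X proj_rep_is_rep i x nil[OF i]]])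
    finally show "untranspose X Y Z g ?j (rep_tensor X Z ?j (amap X \<alpha> x) (amap Z \<alpha> z))
        = amap Y \<alpha> (untranspose X Y Z g ?i (rep_tensor X Z ?i x z))"
      using pure i j x z x' z' by simp
  qed
qed

text \<open>
  Each composite is compared with the identity on the tensors that determine it: \<open>x \<otimes> z\<close> for a morphism
  out of \<open>X \<box> Z\<close>, and \<open>x \<otimes> p\<close> for a value of \<open>g\<close>, where \<open>path_translate\<close> applies.
\<close>

lemma transpose_hom_bij:
  assumes X: "is_rep R Q X" and Y: "is_rep R Q Y" and Z: "is_rep R Q Z"
  shows "bij_betw (transpose_hom R Q X Z) (rep_hom R Q (box R Q X Z) Y) (rep_hom R Q Z (internal_hom R Q X Y))"
proof (rule bij_betw_byWitness[where f' = "untranspose X Y Z"])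
  show "\<forall>f\<in>rep_hom R Q (box R Q X Z) Y. untranspose X Y Z (transpose_hom R Q X Z f) = f"
  proof
    fix f assume f: "f \<in> rep_hom R Q (box R Q X Z) Y"
    note tr = transpose_hom_hom[OF X Y Z f]
    show "untranspose X Y Z (transpose_hom R Q X Z f) = f"
      by (rule box_hom_eqI[OF X Z Y untranspose_hom[OF X Y Z tr] f])
        (simp add: untranspose_pure[OF X Y Z tr] transpose_hom_pure[OF X Z f _ _ _ _ paths_Nil])
  qed
  show "\<forall>g\<in>rep_hom R Q Z (internal_hom R Q X Y). transpose_hom R Q X Z (untranspose X Y Z g) = g"
  proof
    fix g assume g: "g \<in> rep_hom R Q Z (internal_hom R Q X Y)"
    note un = untranspose_hom[OF X Y Z g]
    show "transpose_hom R Q X Z (untranspose X Y Z g) = g"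
    proof (rule rep_hom_eqI[OF transpose_hom_hom[OF X Y Z un] g])
      fix i z assume i: "i \<in> verts Q" and z: "z \<in> carrier (vmod Z i)"
      have "g i z \<in> rep_hom R Q (box R Q X (proj_rep R Q i)) Y"
        using rep_hom_closed[OF g i z] by (simp add: internal_hom_carrier)
      then show "transpose_hom R Q X Z (untranspose X Y Z g) i z = g i z"
        using transpose_hom_pure[OF X Z un i z] untranspose_pure[OF X Y Z g] path_map_closed[OF Z _ z]
          path_translate[OF X Z g _ z]
        by (intro box_proj_hom_eqI[OF X Y transpose_hom_value[OF X Z un i z]]) metis+
    qed
  qed
qed (use transpose_hom_hom[OF X Y Z] untranspose_hom[OF X Y Z] in blast)+

text \<open>
  At \<open>x \<otimes> p\<close> both sides are the value of \<open>f\<close> at \<open>x \<otimes> h (Z'\<^sub>p z) = x \<otimes> Z\<^sub>p (h z)\<close>.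
\<close>

lemma transpose_hom_natural_left:
  assumes X: "is_rep R Q X" and Y: "is_rep R Q Y" and Z: "is_rep R Q Z" and Z': "is_rep R Q Z'"
    and h: "h \<in> rep_hom R Q Z' Z" and f: "f \<in> rep_hom R Q (box R Q X Z) Y"
  shows "transpose_hom R Q X Z' (rep_comp Q (box R Q X Z') f (box_map R Q X Z' Z h))
    = rep_comp Q Z' (transpose_hom R Q X Z f) h"
proof -
  note bh = box_map_hom[OF X Z' Z h]
  note fh = rep_comp_hom[OF box_is_rep[OF X Z'] bh f]
  show ?thesis
  proof (rule rep_hom_eqI[OF transpose_hom_hom[OF X Y Z' fh] rep_comp_hom[OF Z' h transpose_hom_hom[OF X Y Z f]]])
    fix i z assume i: "i \<in> verts Q" and z: "z \<in> carrier (vmod Z' i)"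
    note hz = rep_hom_closed[OF h i z]
    have "transpose_hom R Q X Z' (rep_comp Q (box R Q X Z') f (box_map R Q X Z' Z h)) i z = transpose_hom R Q X Z f i (h i z)"
    proof (rule box_proj_hom_eqI[OF X Y transpose_hom_value[OF X Z' fh i z] transpose_hom_value[OF X Z f i hz]])
      fix k x p assume k: "k \<in> verts Q" and x: "x \<in> carrier (vmod X k)" and p: "p \<in> paths i k"
      note pz = path_map_closed[OF Z' p z]
      show "transpose_hom R Q X Z' (rep_comp Q (box R Q X Z') f (box_map R Q X Z' Z h)) i z k
            (rep_tensor X (proj_rep R Q i) k x (path_gen p))
          = transpose_hom R Q X Z f i (h i z) k (rep_tensor X (proj_rep R Q i) k x (path_gen p))"
        using k by (simp add: transpose_hom_pure[OF X Z' fh i z k x p] transpose_hom_pure[OF X Z f i hz k x p]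
          rep_tensor_closed[OF X Z' k x pz] box_map_pure[OF X Z' Z h k x pz] path_map_natural[OF Z' h p z])
    qed
    then show "transpose_hom R Q X Z' (rep_comp Q (box R Q X Z') f (box_map R Q X Z' Z h)) i z
        = rep_comp Q Z' (transpose_hom R Q X Z f) h i z"
      using i z by simp
  qed
qed

text \<open>
  The transpose of \<open>f\<close> at \<open>z\<close> is the composite of \<open>f\<close> after a morphism that depends only on \<open>z\<close>, so this is associativity of composition.
\<close>

lemma transpose_hom_natural_right:
  assumes X: "is_rep R Q X" and Y: "is_rep R Q Y" and Y': "is_rep R Q Y'" and Z: "is_rep R Q Z"
    and g: "g \<in> rep_hom R Q Y Y'" and f: "f \<in> rep_hom R Q (box R Q X Z) Y"
  shows "transpose_hom R Q X Z (rep_comp Q (box R Q X Z) g f)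
    = rep_comp Q Z (internal_hom_map R Q X Y g) (transpose_hom R Q X Z f)"
proof (rule rep_hom_eqI[OF transpose_hom_hom[OF X Y' Z rep_comp_hom[OF box_is_rep[OF X Z] f g]]
      rep_comp_hom[OF Z transpose_hom_hom[OF X Y Z f] internal_hom_map_hom[OF X Y Y' g]]])
  fix i z assume i: "i \<in> verts Q" and z: "z \<in> carrier (vmod Z i)"
  show "transpose_hom R Q X Z (rep_comp Q (box R Q X Z) g f) i z
      = rep_comp Q Z (internal_hom_map R Q X Y g) (transpose_hom R Q X Z f) i z"
    using i z transpose_hom_value[OF X Z f i z] rep_comp_assoc[OF box_map_hom[OF X proj_rep_is_rep Z yoneda_hom[OF Z z]], of g f]
    by (simp add: internal_hom_map_def, simp add: transpose_hom_def)
qed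

lemma internal_hom_map_id:
  assumes X: "is_rep R Q X"
  shows "internal_hom_map R Q X Y (rep_id Q Y) = rep_id Q (internal_hom R Q X Y)"
  unfolding internal_hom_map_def rep_id_def[of Q "internal_hom R Q X Y"] internal_hom_carrier
  by (intro restrict_ext rep_comp_id_left box_is_rep X proj_rep_is_rep)

lemma internal_hom_map_comp:
  assumes X: "is_rep R Q X" and g: "g \<in> rep_hom R Q Y Y'"
  shows "internal_hom_map R Q X Y (rep_comp Q Y g' g)
    = rep_comp Q (internal_hom R Q X Y) (internal_hom_map R Q X Y' g') (internal_hom_map R Q X Y g)"
  unfolding internal_hom_map_def rep_comp_def[of Q "internal_hom R Q X Y"] internal_hom_carrier
proof (rule restrict_ext)
  fix i assume i: "i \<in> verts Q"
  let ?P = "box R Q X (proj_rep R Q i)"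
  have "rep_comp Q ?P (rep_comp Q Y g' g) \<phi> = rep_comp Q ?P g' (rep_comp Q ?P g \<phi>)"
    and "rep_comp Q ?P g \<phi> \<in> rep_hom R Q ?P Y'" if "\<phi> \<in> rep_hom R Q ?P Y" for \<phi>
    by (rule rep_comp_assoc[OF that, symmetric], rule rep_comp_hom[OF box_is_rep[OF X proj_rep_is_rep] that g])
  with i show "(\<lambda>\<phi>\<in>rep_hom R Q ?P Y. rep_comp Q ?P (rep_comp Q Y g' g) \<phi>)
      = compose (rep_hom R Q ?P Y)
          ((\<lambda>i\<in>verts Q. \<lambda>\<phi>\<in>rep_hom R Q (box R Q X (proj_rep R Q i)) Y'. rep_comp Q (box R Q X (proj_rep R Q i)) g' \<phi>) i)
          ((\<lambda>i\<in>verts Q. \<lambda>\<phi>\<in>rep_hom R Q (box R Q X (proj_rep R Q i)) Y. rep_comp Q (box R Q X (proj_rep R Q i)) g \<phi>) i)"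
    by (auto simp: compose_def intro!: restrict_ext)
qed

end

theorem theorem1p3:
  fixes R :: "('a, 'r) ring_scheme"
    and Q :: "('v, 'e) pre_digraph"
    and X :: "('v, 'e, 'a, 'x) qrep"
    and Y :: "('v, 'e, 'a, 'y) qrep"
  assumes "cring R" and "noetherian_ring R"
    and "fin_digraph Q" and "\<not> (\<exists>p. pre_digraph.cycle Q p)"
    and "is_rep R Q X" and "is_rep R Q Y"
  shows "is_rep R Q (internal_hom R Q X Y) \<and>
    (\<forall>Z :: ('v, 'e, 'a, 'z) qrep. is_rep R Q Z \<longrightarrow>
      bij_betw (transpose_hom R Q X Z)
        (rep_hom R Q (box R Q X Z) Y) (rep_hom R Q Z (internal_hom R Q X Y))) \<and>
    (\<forall>(Z :: ('v, 'e, 'a, 'z) qrep) (Z' :: ('v, 'e, 'a, 'z1) qrep).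
      is_rep R Q Z \<longrightarrow> is_rep R Q Z' \<longrightarrow>
      (\<forall>h\<in>rep_hom R Q Z' Z. \<forall>f\<in>rep_hom R Q (box R Q X Z) Y.
        transpose_hom R Q X Z' (rep_comp Q (box R Q X Z') f (box_map R Q X Z' Z h))
          = rep_comp Q Z' (transpose_hom R Q X Z f) h)) \<and>
    (\<forall>(Z :: ('v, 'e, 'a, 'z) qrep) (Y' :: ('v, 'e, 'a, 'y1) qrep).
      is_rep R Q Z \<longrightarrow> is_rep R Q Y' \<longrightarrow>
      (\<forall>g\<in>rep_hom R Q Y Y'. \<forall>f\<in>rep_hom R Q (box R Q X Z) Y.
        transpose_hom R Q X Z (rep_comp Q (box R Q X Z) g f)
          = rep_comp Q Z (internal_hom_map R Q X Y g) (transpose_hom R Q X Z f))) \<and>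
    (\<forall>Y' :: ('v, 'e, 'a, 'y1) qrep. is_rep R Q Y' \<longrightarrow>
      (\<forall>g\<in>rep_hom R Q Y Y'.
        internal_hom_map R Q X Y g \<in> rep_hom R Q (internal_hom R Q X Y) (internal_hom R Q X Y'))) \<and>
    internal_hom_map R Q X Y (rep_id Q Y) = rep_id Q (internal_hom R Q X Y) \<and>
    (\<forall>(Y' :: ('v, 'e, 'a, 'y1) qrep) (Y'' :: ('v, 'e, 'a, 'y2) qrep).
      is_rep R Q Y' \<longrightarrow> is_rep R Q Y'' \<longrightarrow>
      (\<forall>g\<in>rep_hom R Q Y Y'. \<forall>g'\<in>rep_hom R Q Y' Y''.
        internal_hom_map R Q X Y (rep_comp Q Y g' g)
          = rep_comp Q (internal_hom R Q X Y) (internal_hom_map R Q X Y' g')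
              (internal_hom_map R Q X Y g)))"
proof -
  interpret quiver_over_ring R Q
    using assms(1,3) by (simp add: quiver_over_ring_def fin_digraph_def)
  note X = assms(5) and Y = assms(6)
  show ?thesis
    using internal_hom_is_rep[OF X Y] transpose_hom_bij[OF X Y] transpose_hom_natural_left[OF X Y]
      transpose_hom_natural_right[OF X Y] internal_hom_map_hom[OF X Y] internal_hom_map_id[OF X]
      internal_hom_map_comp[OF X]
    by (intro conjI allI ballI impI) simp_all
qed

end
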